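(* Let $0<\alpha<n$, $1\le s<\frac n\alpha$, $0<p<\infty$, and $w\in A_\infty$. Then there exists $C>0$ such that for any sparse family of cubes $\mathscr S$ and any measurable function $f\ge0$ on $\mathbb R^n$, $$\|I_{\alpha,L^s}^{\mathscr S}f\|_{L^p(w)}\le C\,\big\|[I_{\alpha s}(f^s)]^{\frac1s}\big\|_{L^p(w)}$$ and $$\|I_{\alpha,L^s}^{\mathscr S}f\|_{L^{p,\infty}(w)}\le C\,\big\|[I_{\alpha s}(f^s)]^{\frac1s}\big\|_{L^{p,\infty}(w)}.$$
   Context: $n$ is a positive integer. $A_\infty$ is the Muckenhoupt class $\bigcup_{p\ge 1}A_p$ of weights on $\mathbb R^n$. $L^p(w)$ and $L^{p,\infty}(w)$ are taken with respect to the measure $w\,dx$: $\|g\|_{L^p(w)}=(\int|g|^pw)^{1/p}$, $\|g\|_{L^{p,\infty}(w)}=\sup_{t>0}t\,w(\{|g|>t\})^{1/p}$. For $0<\beta<n$ the Riesz potential is $I_\beta g(x)=c_{n,\beta}\int_{\mathbb R^n}\frac{g(y)}{|x-y|^{n-\beta}}\,dy$, where $c_{n,\beta}>0$ is chosen so that $\widehat{I_\beta g}(\xi)=|\xi|^{-\beta}\hat g(\xi)$. A dyadic grid $\mathscr D$ is a collection of cubes in $\mathbb R^n$ such that every cube has side length $2^k$ for some $k\in\mathbb Z$, for each fixed $k\in\mathbb Z$ the cubes of side length $2^k$ in $\mathscr D$ partition $\mathbb R^n$, and $Q\cap P\in\{\varnothing,P,Q\}$ for all $Q,P\in\mathscr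 D$. A subfamily $\mathscr S\subseteq\mathscr D$ of a dyadic grid is sparse if for each $Q\in\mathscr S$ there is a measurable $E_Q\subseteq Q$ with $|Q|\le2|E_Q|$ and the sets $\{E_Q:Q\in\mathscr S\}$ are pairwise disjoint. $I_{\alpha,L^s}^{\mathscr S}f(x)=\sum_{Q\in\mathscr S}\ell(Q)^\alpha\Big(\frac1{|Q|}\int_Q|f|^s\Big)^{\frac1s}\mathbf 1_Q(x)$, where $\ell(Q)$ is the side length of $Q$. *)

theory Defs
  imports "HOL-Analysis.Analysis" "HOL-Library.Disjoint_Sets"
begin

text \<open>
  Nonnegative functions take values in \<^typ>\<open>ennreal\<close>, so that integrals, sums and norms that may
  diverge have the value \<open>\<infinity>\<close>.  The power below is used only with exponents \<open>r > 0\<close>.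
\<close>

definition epow :: "ennreal \<Rightarrow> real \<Rightarrow> ennreal" where
  "epow x r = (if x = \<infinity> then \<infinity> else ennreal (enn2real x powr r))"

text \<open>
  Cubes have sides parallel to the axes.  Each side is an interval of length \<open>l\<close> which may contain
  any of its endpoints: the two inclusions say exactly that \<open>J i\<close> is one of
  \<open>(a, a+l)\<close>, \<open>[a, a+l)\<close>, \<open>(a, a+l]\<close>, \<open>[a, a+l]\<close>.
\<close>

definition cube_of_side :: "real \<Rightarrow> (real^'n) set \<Rightarrow> bool" where
  "cube_of_side l Q \<longleftrightarrow> 0 < l \<and>
     (\<exists>J. (\<forall>i. \<exists>a. {a<..<a + l} \<subseteq> J i \<and> J i \<subseteq> {a..a + l}) \<and> Q = {x. \<forall>i. x $ i \<in> J i})"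

definition is_cube :: "(real^'n) set \<Rightarrow> bool" where
  "is_cube Q \<longleftrightarrow> (\<exists>l. cube_of_side l Q)"

definition side_length :: "(real^'n) set \<Rightarrow> real" where
  "side_length Q = (THE l. cube_of_side l Q)"

definition dyadic_grid :: "(real^'n) set set \<Rightarrow> bool" where
  "dyadic_grid D \<longleftrightarrow>
     (\<forall>Q\<in>D. \<exists>k::int. cube_of_side (2 powi k) Q) \<and>
     (\<forall>k::int. partition_on UNIV {Q \<in> D. cube_of_side (2 powi k) Q}) \<and>
     (\<forall>Q\<in>D. \<forall>P\<in>D. Q \<inter> P \<in> {{}, P, Q})"

definition sparse_family :: "(real^'n) set set \<Rightarrow> bool" where
  "sparse_family S \<longleftrightarrow> (\<exists>D. dyadic_grid D \<and> S \<subseteq> D) \<and>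
     (\<exists>E. (\<forall>Q\<in>S. E Q \<in> sets lebesgue \<and> E Q \<subseteq> Q \<and>
                emeasure lebesgue Q \<le> 2 * emeasure lebesgue (E Q)) \<and>
          disjoint_family_on E S)"

definition average :: "(real^'n) set \<Rightarrow> (real^'n \<Rightarrow> ennreal) \<Rightarrow> ennreal" where
  "average Q g = (\<integral>\<^sup>+ x\<in>Q. g x \<partial>lebesgue) / emeasure lebesgue Q"

definition sparse_operator ::
  "real \<Rightarrow> real \<Rightarrow> (real^'n) set set \<Rightarrow> (real^'n \<Rightarrow> ennreal) \<Rightarrow> real^'n \<Rightarrow> ennreal" where
  "sparse_operator \<alpha> s S f x =
     (\<Sum>\<^sub>\<infinity>Q\<in>S. ennreal (side_length Q powr \<alpha>) * epow (average Q (\<lambda>y. epow (f y) s)) (1 / s)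
               * indicator Q x)"

definition is_weight :: "(real^'n \<Rightarrow> real) \<Rightarrow> bool" where
  "is_weight w \<longleftrightarrow> w \<in> borel_measurable lebesgue \<and> (\<forall>x. 0 \<le> w x) \<and> (AE x in lebesgue. 0 < w x) \<and>
     (\<forall>K. compact K \<longrightarrow> w absolutely_integrable_on K)"

text \<open>
  For \<open>p > 1\<close> with conjugate exponent \<open>p'\<close>, one has \<open>1 - p' = -1 / (p - 1)\<close>.  For \<open>p = 1\<close> the
  condition is that the average of \<open>w\<close> over \<open>Q\<close> is at most \<open>K\<close> times the essential infimum over \<open>Q\<close>.
\<close>

definition muckenhoupt :: "real \<Rightarrow> (real^'n \<Rightarrow> real) \<Rightarrow> bool" where
  "muckenhoupt p w \<longleftrightarrow> is_weight w \<and>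
     (\<exists>K::real. \<forall>Q. is_cube Q \<longrightarrow>
        (if p = 1
         then AE x in lebesgue. x \<in> Q \<longrightarrow> average Q (\<lambda>y. ennreal (w y)) \<le> ennreal (K * w x)
         else average Q (\<lambda>y. ennreal (w y)) *
              epow (average Q (\<lambda>y. ennreal (w y powr (- 1 / (p - 1))))) (p - 1) \<le> ennreal K))"

definition A_infty :: "(real^'n \<Rightarrow> real) \<Rightarrow> bool" where
  "A_infty w \<longleftrightarrow> (\<exists>p\<ge>1. muckenhoupt p w)"

definition weighted_measure :: "(real^'n \<Rightarrow> real) \<Rightarrow> (real^'n) measure" where
  "weighted_measure w = density lebesgue (\<lambda>x. ennreal (w x))"

definition Lp_norm :: "real \<Rightarrow> (real^'n \<Rightarrow> real) \<Rightarrow> (real^'n \<Rightarrow> ennreal) \<Rightarrow> ennreal" where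
  "Lp_norm p w g = epow (\<integral>\<^sup>+ x. epow (g x) p \<partial>weighted_measure w) (1 / p)"

definition weak_Lp_norm :: "real \<Rightarrow> (real^'n \<Rightarrow> real) \<Rightarrow> (real^'n \<Rightarrow> ennreal) \<Rightarrow> ennreal" where
  "weak_Lp_norm p w g =
     (SUP t\<in>{0::real<..}. ennreal t * epow (emeasure (weighted_measure w) {x. ennreal t < g x}) (1 / p))"

text \<open>
  The Riesz potential with constant \<open>c\<close>, for integrable complex functions and for nonnegative
  functions.  The first form only serves to normalise \<open>c\<close>.
\<close>

definition riesz_potential_complex ::
  "real \<Rightarrow> real \<Rightarrow> (real^'n \<Rightarrow> complex) \<Rightarrow> real^'n \<Rightarrow> complex" where
  "riesz_potential_complex c \<beta> g x =
     of_real c * (LINT y|lebesgue. g y / of_real (norm (x - y) powr (real CARD('n) - \<beta>)))"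

definition riesz_potential ::
  "real \<Rightarrow> real \<Rightarrow> (real^'n \<Rightarrow> ennreal) \<Rightarrow> real^'n \<Rightarrow> ennreal" where
  "riesz_potential c \<beta> g x =
     ennreal c * (\<integral>\<^sup>+ y. g y / ennreal (norm (x - y) powr (real CARD('n) - \<beta>)) \<partial>lebesgue)"

definition fourier_transform :: "(real^'n \<Rightarrow> complex) \<Rightarrow> real^'n \<Rightarrow> complex" where
  "fourier_transform g \<xi> = (LINT x|lebesgue. cis (- (x \<bullet> \<xi>)) * g x)"

text \<open>
  The normalisation of the constant \<open>c = c\<^sub>n\<^sub>,\<^sub>\<beta>\<close>.  The Fourier identity is required for
  those integrable \<open>g\<close> whose potential is again integrable, so that both transforms are given by
  absolutely convergent integrals and are continuous functions.  This class contains every Schwartz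
  function whose Fourier transform has compact support away from the origin, hence the condition
  determines \<open>c\<close> uniquely.
\<close>

definition riesz_constant :: "'n::finite itself \<Rightarrow> real \<Rightarrow> real \<Rightarrow> bool" where
  "riesz_constant n \<beta> c \<longleftrightarrow> 0 < c \<and>
     (\<forall>g :: real^'n \<Rightarrow> complex.
        integrable lebesgue g \<longrightarrow> integrable lebesgue (riesz_potential_complex c \<beta> g) \<longrightarrow>
        (\<forall>\<xi>. \<xi> \<noteq> 0 \<longrightarrow>
           fourier_transform (riesz_potential_complex c \<beta> g) \<xi> =
           of_real (norm \<xi> powr (- \<beta>)) * fourier_transform g \<xi>))"

end

theory Submission
  imports Defs
begin

text \<open>
  Write \<open>g = f\<^sup>s\<close> and \<open>\<beta> = \<alpha>s\<close>, so that the coefficient of a cube \<open>Q\<close> in the sparse operator is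
  \<open>a\<^sub>Q = (\<ell>(Q)\<^sup>\<beta> \<langle>g\<rangle>\<^sub>Q)\<^bsup>1/s\<^esup>\<close>.  Two points of \<open>Q\<close> are at distance at most a multiple of \<open>\<ell>(Q)\<close>, so the
  Riesz kernel is at least a multiple of \<open>\<ell>(Q)\<^bsup>\<beta>-n\<^esup>\<close> on \<open>Q \<times> Q\<close>, and therefore
  \<open>a\<^sub>Q \<le> A (I\<^sub>\<beta> g(x))\<^bsup>1/s\<^esup>\<close> for every \<open>x \<in> Q\<close> (\<open>average_le_riesz_potential\<close>).  The
  theorem is thus a case of the following general principle: if a function \<open>G\<close> dominates each
  coefficient \<open>a\<^sub>Q\<close> on \<open>Q\<close>, then the whole sum \<open>F = \<Sum>\<^sub>Q a\<^sub>Q 1\<^sub>Q\<close> is dominated by \<open>G\<close> in strong and weak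
  \<open>L\<^sup>p(w)\<close> for every \<open>p > 0\<close> (\<open>laminar_sum_bounds\<close>).

  This principle needs only that the cubes are nested or disjoint and that they have disjoint parts
  \<open>E\<^sub>Q \<subseteq> Q\<close> with \<open>w(Q) \<le> K w(E\<^sub>Q)\<close>.  The latter is where \<open>A\<^sub>\<infinity>\<close> enters: in an \<open>A\<^sub>q\<close> weight, a part of
  \<open>Q\<close> with at least half of its Lebesgue measure carries a fixed fraction of its \<open>w\<close>-measure
  (\<open>A_infty_large_subset\<close>).

  The principle is proved by a good-\<open>\<lambda>\<close> inequality (\<open>laminar_good_lambda\<close>).  The cubes that contain a
  point \<open>x\<close> form a chain.  If \<open>F(x) > 2\<lambda>\<close>, then the sum along this chain, starting from the largest cube,
  has to climb from \<open>\<lambda>\<close> to above \<open>2\<lambda>\<close>; if moreover \<open>G(x) \<le> \<lambda>/k\<close>, then each step is at most \<open>\<lambda>/k\<close>,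
  so \<open>x\<close> lies in at least \<open>k\<close> cubes on which the partial sum exceeds \<open>\<lambda>\<close>.  These cubes are
  contained in \<open>{F > \<lambda>}\<close>, and the sum of their \<open>w\<close>-measures is at most \<open>K w(F > \<lambda>)\<close> because the
  sets \<open>E\<^sub>Q\<close> are disjoint.  Hence \<open>w(F > 2\<lambda>, G \<le> \<lambda>/k) \<le> (K/k) w(F > \<lambda>)\<close>, and a large \<open>k\<close> lets the
  right-hand side be absorbed in either norm.  Absorption requires finite norms; this is why the sums are
  first taken over finitely many cubes with bounded coefficients and then pass to the limit monotonically.
\<close>

section \<open>Powers of extended nonnegative numbers\<close>

lemma epow_top [simp]: "epow top r = top"
  by (simp add: epow_def)

lemma epow_ennreal: "0 \<le> x \<Longrightarrow> epow (ennreal x) r = ennreal (x powr r)"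
  by (simp add: epow_def)

lemma epow_0 [simp]: "epow 0 r = 0"
  by (simp add: epow_def)

lemma epow_mono:
  assumes "0 \<le> r" "x \<le> y"
  shows "epow x r \<le> epow y r"
proof (cases x y rule: ennreal2_cases)
  case (real_real a b)
  then show ?thesis using assms by (simp add: epow_ennreal powr_mono2 ennreal_leI)
qed (use assms in \<open>auto simp: top_unique\<close>)

lemma epow_epow_inverse [simp]:
  assumes "0 < r"
  shows "epow (epow x r) (1 / r) = x" "epow (epow x (1 / r)) r = x"
  using assms by (cases x; simp add: epow_ennreal powr_powr)+

lemma epow_mult:
  "epow (x * y) r = epow x r * epow y r"
proof (cases x y rule: ennreal2_cases)
  case (real_real a b)
  then show ?thesis by (simp add: epow_ennreal powr_mult flip: ennreal_mult)
qed (auto simp: epow_ennreal ennreal_mult_top ennreal_top_mult ennreal_eq_0_iff)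

lemma epow_le_iff:
  assumes "0 < r"
  shows "epow x r \<le> epow y r \<longleftrightarrow> x \<le> y"
  using epow_mono[of r x y] epow_mono[of "1 / r" "epow x r" "epow y r"] assms by auto

lemma epow_SUP:
  assumes "0 < r"
  shows "epow (SUP i\<in>I. f i) r = (SUP i\<in>I. epow (f i) r)"
proof (rule antisym)
  have "f i \<le> epow (SUP i\<in>I. epow (f i) r) (1 / r)" if "i \<in> I" for i
    using epow_mono[of "1 / r" "epow (f i) r" "SUP i\<in>I. epow (f i) r"]
      SUP_upper[OF that, of "\<lambda>i. epow (f i) r"] assms by simp
  then have "(SUP i\<in>I. f i) \<le> epow (SUP i\<in>I. epow (f i) r) (1 / r)"
    by (rule SUP_least)
  then have "epow (SUP i\<in>I. f i) r \<le> epow (epow (SUP i\<in>I. epow (f i) r) (1 / r)) r"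
    using assms by (intro epow_mono) auto
  then show "epow (SUP i\<in>I. f i) r \<le> (SUP i\<in>I. epow (f i) r)"
    using assms by simp
  show "(SUP i\<in>I. epow (f i) r) \<le> epow (SUP i\<in>I. f i) r"
    using assms by (intro SUP_least epow_mono SUP_upper) auto
qed

lemma epow_measurable [measurable (raw)]:
  assumes [measurable]: "f \<in> borel_measurable M"
  shows "(\<lambda>x. epow (f x) r) \<in> borel_measurable M"
  unfolding epow_def by measurable

lemma less_epow_iff:
  assumes "0 < p" "0 < b" "0 < v"
  shows "ennreal v < epow (ennreal b * X) p \<longleftrightarrow> ennreal (v powr (1 / p) / b) < X"
proof -
  have v: "ennreal v = epow (ennreal b * ennreal (v powr (1 / p) / b)) p"
    using assms by (simp add: epow_ennreal powr_powr flip: ennreal_mult)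
  have "ennreal v < epow (ennreal b * X) p
      \<longleftrightarrow> ennreal b * ennreal (v powr (1 / p) / b) < ennreal b * X"
    by (subst v) (use assms in \<open>simp add: less_le_not_le epow_le_iff\<close>)
  also have "\<dots> \<longleftrightarrow> ennreal (v powr (1 / p) / b) < X"
    using assms by (simp add: less_le_not_le ennreal_mult_le_mult_iff)
  finally show ?thesis .
qed

section \<open>From good-lambda inequalities to norm bounds\<close>

lemma nn_integral_indicator_below:
  "(\<integral>\<^sup>+ u. indicator {u. 0 < u \<and> ennreal u < y} u \<partial>lborel) = y"
proof (cases y)
  case (real r)
  then have "{u. 0 < u \<and> ennreal u < y} = {0<..<r}"
    by (auto simp: ennreal_less_iff)
  then show ?thesis using real by simp
next
  case top
  have "of_nat n \<le> emeasure lborel {0::real<..}" for n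
  proof -
    have "emeasure lborel {0::real<..<real n} \<le> emeasure lborel {0::real<..}"
      by (intro emeasure_mono) auto
    then show ?thesis by (simp add: ennreal_of_nat_eq_real_of_nat)
  qed
  then have "emeasure lborel {0::real<..} = top"
    by (metis SUP_least ennreal_SUP_of_nat_eq_top top_unique)
  moreover have "{u. 0 < u \<and> ennreal u < y} = {0<..}"
    using top by auto
  ultimately show ?thesis using top by simp
qed

lemma nn_integral_layer_cake:
  assumes "sigma_finite_measure M" and [measurable]: "F \<in> borel_measurable M"
  shows "(\<integral>\<^sup>+ x. F x \<partial>M)
    = (\<integral>\<^sup>+ u. indicator {0<..} u * emeasure M {x \<in> space M. ennreal u < F x} \<partial>lborel)"
proof -
  interpret M: sigma_finite_measure M by fact
  interpret pair_sigma_finite M "lborel :: real measure" ..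
  have "(\<integral>\<^sup>+ x. F x \<partial>M)
      = (\<integral>\<^sup>+ x. \<integral>\<^sup>+ u. indicator {u. 0 < u \<and> ennreal u < F x} u \<partial>lborel \<partial>M)"
    by (simp only: nn_integral_indicator_below)
  also have "\<dots> = (\<integral>\<^sup>+ u. \<integral>\<^sup>+ x. indicator {u. 0 < u \<and> ennreal u < F x} u \<partial>M \<partial>lborel)"
    by (rule Fubini'[symmetric]) measurable
  also have "\<dots> = (\<integral>\<^sup>+ u. indicator {0<..} u * emeasure M {x \<in> space M. ennreal u < F x} \<partial>lborel)"
  proof (rule nn_integral_cong)
    fix u :: real
    have "(\<integral>\<^sup>+ x. indicator {u. 0 < u \<and> ennreal u < F x} u \<partial>M)
       = (\<integral>\<^sup>+ x. indicator {0<..} u * indicator {x \<in> space M. ennreal u < F x} x \<partial>M)"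
      by (intro nn_integral_cong) (auto simp: indicator_def)
    also have "\<dots> = indicator {0<..} u * emeasure M {x \<in> space M. ennreal u < F x}"
      by (subst nn_integral_cmult) simp_all
    finally show "(\<integral>\<^sup>+ x. indicator {u. 0 < u \<and> ennreal u < F x} u \<partial>M) = \<dots>" .
  qed
  finally show ?thesis .
qed

text \<open>
  In the layer cake formula for \<open>F\<^sup>p\<close>, \<open>(F/2)\<^sup>p\<close> and \<open>(kG)\<^sup>p\<close> the level \<open>u\<close> corresponds to the levels
  \<open>l\<close>, \<open>2l\<close> and \<open>l/k\<close> of \<open>F\<close>, \<open>F\<close> and \<open>G\<close>, where \<open>l = u\<^bsup>1/p\<^esup>\<close>.  Integrating the hypothesis over \<open>u\<close>
  therefore gives \<open>2\<^bsup>-p\<^esup> \<integral>F\<^sup>p \<le> \<epsilon> \<integral>F\<^sup>p + k\<^sup>p \<integral>G\<^sup>p\<close>, and the first term on the right is at most half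
  of the left-hand side.
\<close>

lemma good_lambda_strong:
  fixes F G :: "'a \<Rightarrow> ennreal"
  assumes "sigma_finite_measure M"
    and [measurable]: "F \<in> borel_measurable M" "G \<in> borel_measurable M"
    and p: "0 < p" and k: "0 < k" and \<epsilon>: "0 \<le> \<epsilon>" "\<epsilon> * (2 * 2 powr p) \<le> 1"
    and gl: "\<And>l. 0 < l \<Longrightarrow> emeasure M {x \<in> space M. ennreal (2 * l) < F x}
        \<le> ennreal \<epsilon> * emeasure M {x \<in> space M. ennreal l < F x}
          + emeasure M {x \<in> space M. ennreal (l / k) < G x}"
    and fin: "(\<integral>\<^sup>+ x. epow (F x) p \<partial>M) < top"
  shows "(\<integral>\<^sup>+ x. epow (F x) p \<partial>M) \<le> ennreal (2 * (2 * k) powr p) * (\<integral>\<^sup>+ x. epow (G x) p \<partial>M)"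
proof -
  define I where "I = (\<integral>\<^sup>+ x. epow (F x) p \<partial>M)"
  define J where "J = (\<integral>\<^sup>+ x. epow (G x) p \<partial>M)"
  define L where "L b H = (\<lambda>u. emeasure M {x \<in> space M. ennreal u < epow (ennreal b * H x) p})"
    for b and H :: "'a \<Rightarrow> ennreal"
  interpret M: sigma_finite_measure M by fact
  have [measurable]: "L b H \<in> borel_measurable lborel" if [measurable]: "H \<in> borel_measurable M" for b H
    unfolding L_def by measurable
  have scale: "(\<integral>\<^sup>+ u. indicator {0<..} u * L b H u \<partial>lborel) = ennreal (b powr p) * (\<integral>\<^sup>+ x. epow (H x) p \<partial>M)"
    if [measurable]: "H \<in> borel_measurable M" and "0 < b" for b H
  proof -
    have "(\<integral>\<^sup>+ u. indicator {0<..} u * L b H u \<partial>lborel) = (\<integral>\<^sup>+ x. epow (ennreal b * H x) p \<partial>M)"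
      unfolding L_def by (rule nn_integral_layer_cake[symmetric]) (use assms(1) in \<open>auto\<close>)
    then show ?thesis
      using that by (simp add: epow_mult epow_ennreal nn_integral_cmult)
  qed
  have "indicator {0<..} u * L (1/2) F u
      \<le> ennreal \<epsilon> * (indicator {0<..} u * L 1 F u) + indicator {0<..} u * L k G u" for u
  proof (cases "0 < u")
    case True
    have lev: "L b H u = emeasure M {x \<in> space M. ennreal (u powr (1 / p) / b) < H x}" if "0 < b" for b H
      unfolding L_def using True p that by (simp only: less_epow_iff)
    show ?thesis
      using gl[of "u powr (1 / p)"] True k by (simp add: lev mult.commute)
  qed simp
  then have "(\<integral>\<^sup>+ u. indicator {0<..} u * L (1/2) F u \<partial>lborel)
      \<le> (\<integral>\<^sup>+ u. ennreal \<epsilon> * (indicator {0<..} u * L 1 F u) + indicator {0<..} u * L k G u \<partial>lborel)"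
    by (rule nn_integral_mono)
  also have "\<dots> = ennreal \<epsilon> * (\<integral>\<^sup>+ u. indicator {0<..} u * L 1 F u \<partial>lborel)
      + (\<integral>\<^sup>+ u. indicator {0<..} u * L k G u \<partial>lborel)"
    by (simp add: nn_integral_add nn_integral_cmult)
  finally have main: "ennreal ((1/2) powr p) * I \<le> ennreal \<epsilon> * I + ennreal (k powr p) * J"
    using k by (simp add: scale I_def J_def)
  have "I \<le> ennreal (2 * (2 * k) powr p) * J"
  proof (cases J)
    case top
    then show ?thesis using k by (simp add: ennreal_mult_top)
  next
    case (real j)
    obtain i where i: "I = ennreal i" "0 \<le> i"
      using fin by (cases I) (auto simp: I_def)
    have "(1/2) powr p * i \<le> \<epsilon> * i + k powr p * j"
      using main real i \<epsilon> k
      by (simp flip: ennreal_mult ennreal_plus)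
    then have "2 powr p * ((1/2) powr p * i) \<le> 2 powr p * (\<epsilon> * i + k powr p * j)"
      by (rule mult_left_mono) simp
    also have "2 powr p * ((1/2) powr p * i) = i"
      by (simp add: powr_divide)
    finally have "2 * i \<le> \<epsilon> * (2 * 2 powr p) * i + 2 * (2 powr p * k powr p * j)"
      by (simp add: algebra_simps)
    also have "\<dots> \<le> 1 * i + 2 * (2 powr p * k powr p * j)"
      using \<epsilon> i by (intro add_mono mult_right_mono order_refl) auto
    finally have "i \<le> 2 * (2 * k) powr p * j"
      using k by (simp add: powr_mult)
    then show ?thesis
      using i real by (simp add: ennreal_leI flip: ennreal_mult)
  qed
  then show ?thesis by (simp add: I_def J_def)
qed

text \<open>
  Bounding the sum of two measures by twice their maximum avoids a quasi-triangle inequality for the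
  weak norm: either the term with \<open>G\<close> dominates, or the weak norm of \<open>F\<close> is at most half of itself,
  hence zero.
\<close>

lemma good_lambda_weak:
  fixes F G :: "'a \<Rightarrow> ennreal"
  assumes p: "0 < p" and k: "0 < k" and \<epsilon>: "0 \<le> \<epsilon>" "\<epsilon> * (2 * 4 powr p) \<le> 1"
    and gl: "\<And>l. 0 < l \<Longrightarrow> emeasure M {x \<in> space M. ennreal (2 * l) < F x}
        \<le> ennreal \<epsilon> * emeasure M {x \<in> space M. ennreal l < F x}
          + emeasure M {x \<in> space M. ennreal (l / k) < G x}"
    and fin: "(SUP t\<in>{0<..}. ennreal t * epow (emeasure M {x \<in> space M. ennreal t < F x}) (1 / p)) < top"
      (is "?A < top")
  shows "?A \<le> ennreal (2 * k * 2 powr (1 / p))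
      * (SUP t\<in>{0<..}. ennreal t * epow (emeasure M {x \<in> space M. ennreal t < G x}) (1 / p))"
    (is "_ \<le> ennreal ?C * ?B")
proof -
  have half: "(2 * \<epsilon>) powr (1 / p) \<le> 1 / 4"
  proof -
    have "2 * \<epsilon> \<le> (1 / 4) powr p"
      using \<epsilon> by (simp add: powr_divide field_simps)
    then have "(2 * \<epsilon>) powr (1 / p) \<le> ((1 / 4) powr p) powr (1 / p)"
      using \<epsilon> p by (intro powr_mono2) auto
    then show ?thesis using p by (simp add: powr_powr)
  qed
  have "ennreal t * epow (emeasure M {x \<in> space M. ennreal t < F x}) (1 / p)
      \<le> max (ennreal (1 / 2) * ?A) (ennreal ?C * ?B)" if "0 < t" for t
  proof -
    define l where "l = t / 2"
    have l: "0 < l" "t = 2 * l" using that by (auto simp: l_def)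
    define X where "X = emeasure M {x \<in> space M. ennreal l < F x}"
    define Y where "Y = emeasure M {x \<in> space M. ennreal (l / k) < G x}"
    have A: "ennreal l * epow X (1 / p) \<le> ?A"
      unfolding X_def using l by (intro SUP_upper) auto
    have B: "ennreal (l / k) * epow Y (1 / p) \<le> ?B"
      unfolding Y_def using l k by (intro SUP_upper) auto
    have "emeasure M {x \<in> space M. ennreal t < F x} \<le> ennreal \<epsilon> * X + Y"
      using gl l by (auto simp: X_def Y_def)
    also have "\<dots> \<le> max (ennreal (2 * \<epsilon>) * X) (ennreal 2 * Y)"
    proof (cases "ennreal \<epsilon> * X \<le> Y")
      case True
      then have "ennreal \<epsilon> * X + Y \<le> ennreal 2 * Y"
        by (simp add: mult_2 add_mono)
      then show ?thesis by (simp add: max.coboundedI2)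
    next
      case False
      then have "ennreal \<epsilon> * X + Y \<le> 2 * (ennreal \<epsilon> * X)"
        by (auto simp: mult_2 intro!: add_mono)
      also have "\<dots> = ennreal (2 * \<epsilon>) * X"
        using \<epsilon> by (simp add: ennreal_mult mult.assoc)
      finally show ?thesis by (simp add: max.coboundedI1)
    qed
    finally have "epow (emeasure M {x \<in> space M. ennreal t < F x}) (1 / p)
       \<le> epow (max (ennreal (2 * \<epsilon>) * X) (ennreal 2 * Y)) (1 / p)"
      using p by (intro epow_mono) auto
    then have "ennreal t * epow (emeasure M {x \<in> space M. ennreal t < F x}) (1 / p)
       \<le> ennreal t * epow (max (ennreal (2 * \<epsilon>) * X) (ennreal 2 * Y)) (1 / p)"
      by (rule mult_left_mono) simp
    also have "\<dots> \<le> max (ennreal t * (ennreal ((2 * \<epsilon>) powr (1 / p)) * epow X (1 / p)))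
        (ennreal t * (ennreal (2 powr (1 / p)) * epow Y (1 / p)))"
      using \<epsilon> by (auto simp: max_def epow_mult epow_ennreal simp del: ennreal_numeral)
    also have "\<dots> \<le> max (ennreal (1 / 2) * ?A) (ennreal ?C * ?B)"
    proof (rule max.mono)
      have "ennreal t * (ennreal ((2 * \<epsilon>) powr (1 / p)) * epow X (1 / p))
         \<le> ennreal t * (ennreal (1 / 4) * epow X (1 / p))"
        using half by (intro mult_left_mono mult_right_mono ennreal_leI) auto
      also have "\<dots> = ennreal (1 / 2) * (ennreal l * epow X (1 / p))"
        using l by (simp only: mult.assoc[symmetric] ennreal_mult[symmetric]) (simp add: ennreal_mult[symmetric])
      also have "\<dots> \<le> ennreal (1 / 2) * ?A"
        using A by (intro mult_left_mono) auto
      finally show "ennreal t * (ennreal ((2 * \<epsilon>) powr (1 / p)) * epow X (1 / p)) \<le> \<dots>" .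
      have "ennreal t * (ennreal (2 powr (1 / p)) * epow Y (1 / p))
         = ennreal ?C * (ennreal (l / k) * epow Y (1 / p))"
        using l k by (simp add: mult.assoc[symmetric] flip: ennreal_mult) (simp add: mult_ac)
      also have "\<dots> \<le> ennreal ?C * ?B"
        using B by (intro mult_left_mono) auto
      finally show "ennreal t * (ennreal (2 powr (1 / p)) * epow Y (1 / p)) \<le> \<dots>" .
    qed
    finally show ?thesis .
  qed
  then have "?A \<le> max (ennreal (1 / 2) * ?A) (ennreal ?C * ?B)"
    by (intro SUP_least) auto
  then have "?A \<le> ennreal (1 / 2) * ?A \<or> ?thesis"
    by (simp only: le_max_iff_disj)
  moreover have ?thesis if "?A \<le> ennreal (1 / 2) * ?A"
  proof -
    obtain a where a: "?A = ennreal a" "0 \<le> a"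
      using fin by (cases ?A) auto
    have "ennreal (1 / 2) * ennreal a = ennreal (a / 2)"
      using a by (subst ennreal_mult[symmetric]) auto
    with that a have "ennreal a \<le> ennreal (a / 2)"
      by metis
    then have "a \<le> a / 2"
      using a by (subst (asm) ennreal_le_iff) auto
    then have "?A = 0" using a by simp
    then show ?thesis by (simp only: zero_le)
  qed
  ultimately show ?thesis
    by blast
qed

section \<open>Sums over nested families of sets\<close>

definition laminar :: "'a set set \<Rightarrow> bool" where
  "laminar S \<longleftrightarrow> (\<forall>Q\<in>S. \<forall>P\<in>S. Q \<inter> P \<in> {{}, P, Q})"

lemma laminar_subset: "laminar S \<Longrightarrow> T \<subseteq> S \<Longrightarrow> laminar T"
  unfolding laminar_def by (meson subsetD)

lemma laminarD:
  assumes "laminar S" "P \<in> S" "Q \<in> S"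
  shows "P \<inter> Q = {} \<or> P \<inter> Q = P \<or> P \<inter> Q = Q"
proof -
  from assms(1) have "\<forall>P'\<in>S. P \<inter> P' \<in> {{}, P', P}"
    unfolding laminar_def using assms(2) by (rule bspec)
  then have "P \<inter> Q \<in> {{}, Q, P}" using assms(3) by (rule bspec)
  then show ?thesis unfolding insert_iff empty_iff by argo
qed

text \<open>
  The members of \<open>S\<close> that contain \<open>x\<close> form a chain, and the sum over all supersets is larger for smaller
  sets.  So the sets counted here are all supersets of the smallest one among them, whose own superset
  sum is at most \<open>l\<close>.
\<close>

lemma laminar_chain_sum_le:
  fixes a :: "'a set \<Rightarrow> ennreal"
  assumes "finite S" "laminar S"
  shows "(\<Sum>P | P \<in> S \<and> x \<in> P \<and> (\<Sum>R | R \<in> S \<and> P \<subseteq> R. a R) \<le> l. a P) \<le> l"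
    (is "sum a ?A \<le> l")
proof (cases "?A = {}")
  case True
  show ?thesis unfolding True by simp
next
  case False
  define A where "A = ?A"
  have "finite A" "A \<noteq> {}" using assms False by (simp_all add: A_def)
  from finite_has_minimal[OF this] obtain P0 where P0: "P0 \<in> A" "\<And>P. P \<in> A \<Longrightarrow> P \<subseteq> P0 \<Longrightarrow> P0 = P"
    by blast
  have A: "P \<in> S" "x \<in> P" if "P \<in> A" for P using that by (simp_all add: A_def)
  have "P0 \<subseteq> P" if P: "P \<in> A" for P
    using laminarD[OF assms(2) A(1)[OF P] A(1)[OF P0(1)]] A(2)[OF P] A(2)[OF P0(1)] P0(2)[OF P]
    by blast
  then have "A \<subseteq> {R \<in> S. P0 \<subseteq> R}" using A(1) by blast
  then have "sum a A \<le> (\<Sum>R | R \<in> S \<and> P0 \<subseteq> R. a R)"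
    using assms by (intro sum_mono2) auto
  also have "\<dots> \<le> l" using P0(1) by (simp add: A_def)
  finally show ?thesis by (simp only: A_def)
qed

text \<open>
  A point with \<open>F > 2l\<close> and \<open>G \<le> l/k\<close> lies in at least \<open>k\<close> of the sets on which the sum over all
  supersets exceeds \<open>l\<close>: the remaining sets containing it contribute at most \<open>l\<close>, and each set
  contributes at most \<open>l/k\<close>.  Chebyshev's inequality for the number of these sets, together with
  \<open>\<mu>(P) \<le> K \<mu>(E P)\<close> and the disjointness of the sets \<open>E P\<close>, gives the bound.
\<close>

lemma laminar_good_lambda:
  fixes a :: "'a set \<Rightarrow> ennreal" and G :: "'a \<Rightarrow> ennreal" and K :: real
  assumes S: "finite S" "laminar S" "S \<subseteq> sets M"
    and E: "\<And>P. P \<in> S \<Longrightarrow> E P \<in> sets M" "\<And>P. P \<in> S \<Longrightarrow> E P \<subseteq> P"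
      "\<And>P. P \<in> S \<Longrightarrow> emeasure M P \<le> ennreal K * emeasure M (E P)" "disjoint_family_on E S"
    and [measurable]: "G \<in> borel_measurable M"
    and aG: "\<And>P x. P \<in> S \<Longrightarrow> x \<in> P \<Longrightarrow> a P \<le> G x"
    and K: "0 \<le> K" and k: "0 < (k::nat)" and l: "0 < (l::real)"
  defines "F \<equiv> \<lambda>x. \<Sum>P\<in>S. a P * indicator P x"
  shows "emeasure M {x \<in> space M. ennreal (2 * l) < F x}
    \<le> ennreal (K / k) * emeasure M {x \<in> space M. ennreal l < F x}
      + emeasure M {x \<in> space M. ennreal (l / k) < G x}"
proof -
  \<comment> \<open>\<open>T\<close> collects the sets on which the sum along the chain has already passed the level \<open>l\<close>.\<close>
  define T where "T = {P \<in> S. ennreal l < (\<Sum>R | R \<in> S \<and> P \<subseteq> R. a R)}"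
  define B where "B = {x \<in> space M. ennreal (2 * l) < F x \<and> G x \<le> ennreal (l / k)}"
  have T: "T \<subseteq> S" "finite T" using S by (auto simp: T_def)
  have [measurable]: "P \<in> sets M" if "P \<in> S" for P using S that by auto
  have [measurable]: "F \<in> borel_measurable M" unfolding F_def by measurable
  have F_alt: "F x = (\<Sum>P | P \<in> S \<and> x \<in> P. a P)" for x
    unfolding F_def using S(1) by (intro sum.mono_neutral_cong_right) (auto simp: indicator_def)
  have above: "P \<subseteq> {x \<in> space M. ennreal l < F x}" if "P \<in> T" for P
  proof
    fix x assume x: "x \<in> P"
    have "ennreal l < (\<Sum>R | R \<in> S \<and> P \<subseteq> R. a R)" using that by (simp add: T_def)
    also have "\<dots> \<le> F x" unfolding F_alt using S(1) x by (intro sum_mono2) auto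
    finally show "x \<in> {x \<in> space M. ennreal l < F x}"
      using that T sets.sets_into_space x S(3) by blast
  qed
  have count: "of_nat k * indicator B x \<le> (\<Sum>P\<in>T. indicator P x :: ennreal)" for x
  proof (cases "x \<in> B")
    case True
    define N where "N = card {P \<in> T. x \<in> P}"
    have sumN: "(\<Sum>P\<in>T. indicator P x :: ennreal) = of_nat N"
      using T by (simp add: N_def indicator_def sum.If_cases Int_def)
    have "k \<le> N"
    proof (rule ccontr)
      assume "\<not> k \<le> N"
      then have N: "N \<le> k" by simp
      have "F x = (\<Sum>P | P \<in> S \<and> x \<in> P \<and> (\<Sum>R | R \<in> S \<and> P \<subseteq> R. a R) \<le> l. a P)
          + (\<Sum>P | P \<in> T \<and> x \<in> P. a P)"
        unfolding F_alt using S(1) T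
        by (subst sum.union_disjoint[symmetric]) (auto simp: T_def not_le intro!: sum.cong)
      also have "\<dots> \<le> ennreal l + (\<Sum>P | P \<in> T \<and> x \<in> P. ennreal (l / k))"
      proof (intro add_mono sum_mono laminar_chain_sum_le S)
        fix P assume "P \<in> {P. P \<in> T \<and> x \<in> P}"
        then have "a P \<le> G x" using aG T by blast
        also have "\<dots> \<le> ennreal (l / k)" using True by (simp add: B_def)
        finally show "a P \<le> ennreal (l / k)" .
      qed
      also have "\<dots> = ennreal (l + N * (l / k))"
        using l by (simp add: N_def ennreal_of_nat_eq_real_of_nat flip: ennreal_mult ennreal_plus)
      also have "\<dots> \<le> ennreal (l + k * (l / k))"
        using N l by (intro ennreal_leI add_left_mono mult_right_mono) auto
      also have "\<dots> = ennreal (2 * l)" using k by simp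
      finally show False using True by (auto simp: B_def dest: leD)
    qed
    then have "(of_nat k :: ennreal) \<le> of_nat N" by simp
    then show ?thesis unfolding sumN using True by simp
  qed simp
  have [measurable]: "B \<in> sets M" unfolding B_def by measurable
  have TM: "P \<in> sets M" if "P \<in> T" for P using that T S by auto
  have "of_nat k * emeasure M B = (\<integral>\<^sup>+ x. of_nat k * indicator B x \<partial>M)"
    by (simp add: nn_integral_cmult_indicator)
  also have "\<dots> \<le> (\<integral>\<^sup>+ x. (\<Sum>P\<in>T. indicator P x) \<partial>M)"
    by (intro nn_integral_mono count)
  also have "\<dots> = (\<Sum>P\<in>T. emeasure M P)"
    using TM by (subst nn_integral_sum) auto
  also have "\<dots> \<le> (\<Sum>P\<in>T. ennreal K * emeasure M (E P))"
    using E T by (intro sum_mono) auto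
  also have "\<dots> = ennreal K * emeasure M (\<Union>P\<in>T. E P)"
    using E(1) T disjoint_family_on_mono[OF T(1) E(4)]
    by (subst sum_distrib_left[symmetric], subst sum_emeasure) auto
  also have "\<dots> \<le> ennreal K * emeasure M {x \<in> space M. ennreal l < F x}"
  proof (intro mult_left_mono emeasure_mono)
    show "(\<Union>P\<in>T. E P) \<subseteq> {x \<in> space M. ennreal l < F x}"
    proof (rule UN_least)
      show "E P \<subseteq> {x \<in> space M. ennreal l < F x}" if "P \<in> T" for P
        using E(2)[of P] above[OF that] T(1) that by (meson order_trans subsetD)
    qed
  qed simp_all
  finally have "ennreal (1 / k) * (of_nat k * emeasure M B)
      \<le> ennreal (1 / k) * (ennreal K * emeasure M {x \<in> space M. ennreal l < F x})"
    by (rule mult_left_mono) simp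
  then have B: "emeasure M B \<le> ennreal (K / k) * emeasure M {x \<in> space M. ennreal l < F x}"
    using k K by (simp add: mult.assoc[symmetric] ennreal_of_nat_eq_real_of_nat flip: ennreal_mult)
  have "emeasure M {x \<in> space M. ennreal (2 * l) < F x}
      \<le> emeasure M (B \<union> {x \<in> space M. ennreal (l / k) < G x})"
    by (intro emeasure_mono) (auto simp: B_def)
  also have "\<dots> \<le> emeasure M B + emeasure M {x \<in> space M. ennreal (l / k) < G x}"
    by (intro emeasure_subadditive) auto
  finally show ?thesis using B by (meson add_right_mono order_trans)
qed

text \<open>
  For finitely many sets of finite measure and finite coefficients, \<open>F\<close> is bounded and supported on a set
  of finite measure, so that both of its norms are finite and can be absorbed.  The condition on \<open>k\<close>
  makes the factor \<open>K/k\<close> small enough for the strong and for the weak bound.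
\<close>

lemma laminar_sum_bounds_finite:
  fixes p K :: real
  assumes "sigma_finite_measure M" and p: "0 < p" and K: "0 \<le> K"
    and S: "finite S" "laminar S" "S \<subseteq> sets M"
    and fin: "\<And>P. P \<in> S \<Longrightarrow> emeasure M P < top"  "\<And>P. P \<in> S \<Longrightarrow> a P < top"
    and E: "\<And>P. P \<in> S \<Longrightarrow> E P \<in> sets M" "\<And>P. P \<in> S \<Longrightarrow> E P \<subseteq> P"
      "\<And>P. P \<in> S \<Longrightarrow> emeasure M P \<le> ennreal K * emeasure M (E P)" "disjoint_family_on E S"
    and [measurable]: "G \<in> borel_measurable M"
    and aG: "\<And>P x. P \<in> S \<Longrightarrow> x \<in> P \<Longrightarrow> a P \<le> G x"
    and k: "0 < (k::nat)" "2 * 4 powr p * K \<le> real k"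
  defines "F \<equiv> \<lambda>x. \<Sum>P\<in>S. a P * indicator P x"
  shows "(\<integral>\<^sup>+ x. epow (F x) p \<partial>M) \<le> ennreal (2 * (2 * real k) powr p) * (\<integral>\<^sup>+ x. epow (G x) p \<partial>M)"
    and "(SUP t\<in>{0<..}. ennreal t * epow (emeasure M {x \<in> space M. ennreal t < F x}) (1 / p))
      \<le> ennreal (2 * real k * 2 powr (1 / p))
        * (SUP t\<in>{0<..}. ennreal t * epow (emeasure M {x \<in> space M. ennreal t < G x}) (1 / p))"
proof -
  have [measurable]: "P \<in> sets M" if "P \<in> S" for P using S that by auto
  have [measurable]: "F \<in> borel_measurable M" unfolding F_def by measurable
  define U where "U = \<Union>S"
  have [measurable]: "U \<in> sets M" unfolding U_def using S by (intro sets.finite_Union) auto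
  have "emeasure M U \<le> (\<Sum>P\<in>S. emeasure M P)"
    unfolding U_def using S emeasure_subadditive_finite[of S id M] by simp
  also have "\<dots> < top" using fin S by simp
  finally obtain u where u: "emeasure M U = ennreal u" "0 \<le> u"
    by (cases "emeasure M U") auto
  have "(\<Sum>P\<in>S. a P) < top" using fin S by simp
  then obtain b where b: "(\<Sum>P\<in>S. a P) = ennreal b" "0 \<le> b"
    by (cases "\<Sum>P\<in>S. a P") auto
  have Fb: "F x \<le> ennreal b * indicator U x" for x
  proof (cases "x \<in> U")
    case True
    have "F x \<le> (\<Sum>P\<in>S. a P * 1)"
      unfolding F_def by (intro sum_mono mult_left_mono) (auto simp: indicator_def)
    then show ?thesis using True b by simp
  qed (auto simp: F_def U_def indicator_def sum_nonneg_eq_0_iff S)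
  have "(\<integral>\<^sup>+ x. epow (F x) p \<partial>M) \<le> (\<integral>\<^sup>+ x. ennreal (b powr p) * indicator U x \<partial>M)"
  proof (rule nn_integral_mono)
    fix x
    show "epow (F x) p \<le> ennreal (b powr p) * indicator U x"
      using epow_mono[OF _ Fb, of p x] p b by (auto simp: indicator_def epow_ennreal split: if_splits)
  qed
  also have "\<dots> = ennreal (b powr p * u)"
    using u by (simp add: nn_integral_cmult_indicator ennreal_mult)
  also have "\<dots> < top" by simp
  finally have finF: "(\<integral>\<^sup>+ x. epow (F x) p \<partial>M) < top" .
  have "ennreal t * epow (emeasure M {x \<in> space M. ennreal t < F x}) (1 / p) \<le> ennreal (b * u powr (1 / p))"
    if t: "0 < t" for t
  proof (cases "t < b")
    case True
    have "x \<in> U" if "ennreal t < F x" for x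
      using Fb[of x] that by (cases "x \<in> U") auto
    then have "emeasure M {x \<in> space M. ennreal t < F x} \<le> emeasure M U"
      by (intro emeasure_mono) auto
    then have "ennreal t * epow (emeasure M {x \<in> space M. ennreal t < F x}) (1 / p)
        \<le> ennreal b * epow (ennreal u) (1 / p)"
      using True t p u by (intro mult_mono epow_mono ennreal_leI) auto
    then show ?thesis using u b by (simp add: epow_ennreal ennreal_mult)
  next
    case False
    have "F x \<le> ennreal t" for x
      using False b by (intro order_trans[OF Fb]) (auto simp: indicator_def ennreal_leI)
    then have "{x \<in> space M. ennreal t < F x} = {}" by (auto simp: not_less)
    then show ?thesis by (simp only: emeasure_empty epow_0) simp
  qed
  then have "(SUP t\<in>{0<..}. ennreal t * epow (emeasure M {x \<in> space M. ennreal t < F x}) (1 / p))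
      \<le> ennreal (b * u powr (1 / p))"
    by (intro SUP_least) auto
  also have "\<dots> < top" by simp
  finally have finW: "(SUP t\<in>{0<..}. ennreal t * epow (emeasure M {x \<in> space M. ennreal t < F x}) (1 / p)) < top" .
  have gl: "emeasure M {x \<in> space M. ennreal (2 * l) < F x}
    \<le> ennreal (K / k) * emeasure M {x \<in> space M. ennreal l < F x}
      + emeasure M {x \<in> space M. ennreal (l / k) < G x}" if "0 < l" for l
    unfolding F_def by (rule laminar_good_lambda[OF S E]) (use that K k aG in auto)
  have \<epsilon>4: "K / k * (2 * 4 powr p) \<le> 1" using k by (simp add: field_simps)
  have "K / k * (2 * 2 powr p) \<le> K / k * (2 * 4 powr p)"
    using K p by (intro mult_left_mono powr_mono2) auto
  with \<epsilon>4 have \<epsilon>2: "K / k * (2 * 2 powr p) \<le> 1" by simp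
  show "(\<integral>\<^sup>+ x. epow (F x) p \<partial>M) \<le> ennreal (2 * (2 * real k) powr p) * (\<integral>\<^sup>+ x. epow (G x) p \<partial>M)"
    by (rule good_lambda_strong[OF assms(1) _ _ p _ _ \<epsilon>2 gl finF]) (use K k in auto)
  show "(SUP t\<in>{0<..}. ennreal t * epow (emeasure M {x \<in> space M. ennreal t < F x}) (1 / p))
      \<le> ennreal (2 * real k * 2 powr (1 / p))
        * (SUP t\<in>{0<..}. ennreal t * epow (emeasure M {x \<in> space M. ennreal t < G x}) (1 / p))"
    by (rule good_lambda_weak[OF p _ _ \<epsilon>4 gl finW]) (use K k in auto)
qed

lemma countable_sum_approximation:
  fixes a :: "'b \<Rightarrow> ennreal" and ind :: "'b \<Rightarrow> 'a \<Rightarrow> ennreal"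
  assumes "countable S"
  obtains T :: "nat \<Rightarrow> 'b set"
  where "\<And>n. finite (T n)" "\<And>n. T n \<subseteq> S"
    "\<And>x. incseq (\<lambda>n. \<Sum>P\<in>T n. min (a P) (of_nat n) * ind P x)"
    "\<And>x. (SUP n. \<Sum>P\<in>T n. min (a P) (of_nat n) * ind P x) = (\<Sum>\<^sub>\<infinity>P\<in>S. a P * ind P x)"
proof -
  obtain T where T: "\<And>n. finite (T n)" "incseq T" "(\<Union>n. T n) = S"
  proof (cases "S = {}")
    case True
    then show ?thesis using that[of "\<lambda>n. {}"] by (auto simp: incseq_def)
  next
    case False
    show ?thesis
    proof (rule that[of "\<lambda>n. from_nat_into S ` {..n}"])
      show "incseq (\<lambda>n. from_nat_into S ` {..n})" by (auto simp: incseq_def)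
      have "(\<Union>n. from_nat_into S ` {..n}) = range (from_nat_into S)" by blast
      then show "(\<Union>n. from_nat_into S ` {..n}) = S"
        by (simp only: range_from_nat_into[OF False assms])
    qed simp
  qed
  have TS: "T n \<subseteq> S" for n using T by auto
  have inc: "incseq (\<lambda>n. \<Sum>P\<in>T n. min (a P) (of_nat n) * ind P x)" for x
  proof (rule incseq_SucI)
    fix n
    have "(\<Sum>P\<in>T n. min (a P) (of_nat n) * ind P x) \<le> (\<Sum>P\<in>T n. min (a P) (of_nat (Suc n)) * ind P x)"
      by (intro sum_mono mult_right_mono min.mono of_nat_mono) auto
    also have "\<dots> \<le> (\<Sum>P\<in>T (Suc n). min (a P) (of_nat (Suc n)) * ind P x)"
      using T(1) incseq_SucD[OF T(2)] by (intro sum_mono2) auto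
    finally show "(\<Sum>P\<in>T n. min (a P) (of_nat n) * ind P x)
       \<le> (\<Sum>P\<in>T (Suc n). min (a P) (of_nat (Suc n)) * ind P x)" .
  qed
  have "(SUP n. \<Sum>P\<in>T n. min (a P) (of_nat n) * ind P x) = (\<Sum>\<^sub>\<infinity>P\<in>S. a P * ind P x)" (is "?L = ?R") for x
  proof (rule antisym)
    have R: "?R = (SUP A\<in>{A. finite A \<and> A \<subseteq> S}. \<Sum>P\<in>A. a P * ind P x)"
      by (rule nonneg_infsum_complete) simp
    show "?L \<le> ?R"
    proof (rule SUP_least)
      fix n
      have "(\<Sum>P\<in>T n. min (a P) (of_nat n) * ind P x) \<le> (\<Sum>P\<in>T n. a P * ind P x)"
        by (intro sum_mono mult_right_mono) auto
      also have "\<dots> \<le> ?R" unfolding R using T(1) TS by (intro SUP_upper) auto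
      finally show "(\<Sum>P\<in>T n. min (a P) (of_nat n) * ind P x) \<le> ?R" .
    qed
    show "?R \<le> ?L"
      unfolding R
    proof (rule SUP_least, clarify)
      fix A assume A: "finite A" "A \<subseteq> S"
      have "\<exists>m. A \<subseteq> T m" using A
      proof (induction A rule: finite_induct)
        case (insert P A)
        then obtain m m' where "A \<subseteq> T m" "P \<in> T m'" using T(3) by auto
        then have "insert P A \<subseteq> T (max m m')"
          using incseqD[OF T(2), of m "max m m'"] incseqD[OF T(2), of m' "max m m'"] by auto
        then show ?case by blast
      qed simp
      then obtain m where m: "A \<subseteq> T m" by blast
      have "(SUP n. min (a P) (of_nat n)) = a P" for P
        using inf_SUP[of "a P" of_nat UNIV] by (simp add: inf_min ennreal_SUP_of_nat_eq_top)
      then have "(\<Sum>P\<in>A. a P * ind P x) = (\<Sum>P\<in>A. SUP n. min (a P) (of_nat n) * ind P x)"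
        by (simp flip: SUP_mult_right_ennreal)
      also have "\<dots> = (SUP n. \<Sum>P\<in>A. min (a P) (of_nat n) * ind P x)"
        by (rule ennreal_SUP_sum[symmetric])
          (auto simp: incseq_def intro!: mult_right_mono min.mono of_nat_mono)
      also have "\<dots> \<le> ?L"
      proof (rule SUP_least)
        fix n
        have "(\<Sum>P\<in>A. min (a P) (of_nat n) * ind P x)
            \<le> (\<Sum>P\<in>A. min (a P) (of_nat (max m n)) * ind P x)"
          by (intro sum_mono mult_right_mono min.mono of_nat_mono) auto
        also have "\<dots> \<le> (\<Sum>P\<in>T (max m n). min (a P) (of_nat (max m n)) * ind P x)"
          using T(1) m incseqD[OF T(2), of m "max m n"] by (intro sum_mono2) auto
        also have "\<dots> \<le> ?L" by (rule SUP_upper) simp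
        finally show "(\<Sum>P\<in>A. min (a P) (of_nat n) * ind P x) \<le> ?L" .
      qed
      finally show "(\<Sum>P\<in>A. a P * ind P x) \<le> ?L" .
    qed
  qed
  with T(1) TS inc show ?thesis by (rule that)
qed

text \<open>
  Truncating \<open>a P\<close> at \<open>n\<close> preserves \<open>a P \<le> G\<close> on \<open>P\<close>, so the finite case applies to every approximating
  sum with the same constants, and both sides pass to the limit by monotone convergence.
\<close>

lemma laminar_sum_bounds:
  fixes p K :: real
  assumes "sigma_finite_measure M" and p: "0 < p" and K: "0 \<le> K"
    and S: "countable S" "laminar S" "S \<subseteq> sets M"
    and fin: "\<And>P. P \<in> S \<Longrightarrow> emeasure M P < top"
    and E: "\<And>P. P \<in> S \<Longrightarrow> E P \<in> sets M" "\<And>P. P \<in> S \<Longrightarrow> E P \<subseteq> P"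
      "\<And>P. P \<in> S \<Longrightarrow> emeasure M P \<le> ennreal K * emeasure M (E P)" "disjoint_family_on E S"
    and [measurable]: "G \<in> borel_measurable M"
    and aG: "\<And>P x. P \<in> S \<Longrightarrow> x \<in> P \<Longrightarrow> a P \<le> G x"
    and k: "0 < (k::nat)" "2 * 4 powr p * K \<le> real k"
  defines "F \<equiv> \<lambda>x. \<Sum>\<^sub>\<infinity>P\<in>S. a P * indicator P x"
  shows "(\<integral>\<^sup>+ x. epow (F x) p \<partial>M) \<le> ennreal (2 * (2 * real k) powr p) * (\<integral>\<^sup>+ x. epow (G x) p \<partial>M)"
    and "(SUP t\<in>{0<..}. ennreal t * epow (emeasure M {x \<in> space M. ennreal t < F x}) (1 / p))
      \<le> ennreal (2 * real k * 2 powr (1 / p))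
        * (SUP t\<in>{0<..}. ennreal t * epow (emeasure M {x \<in> space M. ennreal t < G x}) (1 / p))"
proof -
  obtain T where T: "\<And>n. finite (T n)" "\<And>n. T n \<subseteq> S"
    "\<And>x. incseq (\<lambda>n. \<Sum>P\<in>T n. min (a P) (of_nat n) * indicator P x)"
    "\<And>x. (SUP n. \<Sum>P\<in>T n. min (a P) (of_nat n) * indicator P x) = (\<Sum>\<^sub>\<infinity>P\<in>S. a P * indicator P x)"
    using countable_sum_approximation[OF S(1), where ind = indicator and a = a] by blast
  define H where "H n x = (\<Sum>P\<in>T n. min (a P) (of_nat n) * indicator P x)" for n x
  have H: "incseq (\<lambda>n. H n x)" "F x = (SUP n. H n x)" for x
    using T(3,4) by (simp_all add: H_def F_def)
  have [measurable]: "P \<in> sets M" if "P \<in> T n" for P n using S T that by auto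
  have [measurable]: "H n \<in> borel_measurable M" for n unfolding H_def by measurable
  have bd: "(\<integral>\<^sup>+ x. epow (H n x) p \<partial>M) \<le> ennreal (2 * (2 * real k) powr p) * (\<integral>\<^sup>+ x. epow (G x) p \<partial>M)"
    "(SUP t\<in>{0<..}. ennreal t * epow (emeasure M {x \<in> space M. ennreal t < H n x}) (1 / p))
      \<le> ennreal (2 * real k * 2 powr (1 / p))
        * (SUP t\<in>{0<..}. ennreal t * epow (emeasure M {x \<in> space M. ennreal t < G x}) (1 / p))" for n
  proof -
    have Ga: "min (a P) (of_nat n) \<le> G x" if "P \<in> T n" "x \<in> P" for P x
      using aG[of P x] T(2)[of n] that by (auto intro: min.coboundedI1)
    have fin': "min (a P) (of_nat n) < top" for P
      by (simp add: min_less_iff_disj of_nat_less_top)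
    note * = laminar_sum_bounds_finite[OF assms(1) p K T(1)[of n] laminar_subset[OF S(2) T(2)]
        order_trans[OF T(2) S(3)], where E = E and a = "\<lambda>P. min (a P) (of_nat n)" and G = G and k = k]
    show "(\<integral>\<^sup>+ x. epow (H n x) p \<partial>M) \<le> ennreal (2 * (2 * real k) powr p) * (\<integral>\<^sup>+ x. epow (G x) p \<partial>M)"
      unfolding H_def
      by (rule *) (use fin E(1-3) disjoint_family_on_mono[OF T(2) E(4)] Ga fin' k T(2) \<open>G \<in> borel_measurable M\<close> in blast)+
    show "(SUP t\<in>{0<..}. ennreal t * epow (emeasure M {x \<in> space M. ennreal t < H n x}) (1 / p))
      \<le> ennreal (2 * real k * 2 powr (1 / p))
        * (SUP t\<in>{0<..}. ennreal t * epow (emeasure M {x \<in> space M. ennreal t < G x}) (1 / p))"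
      unfolding H_def
      by (rule *) (use fin E(1-3) disjoint_family_on_mono[OF T(2) E(4)] Ga fin' k T(2) \<open>G \<in> borel_measurable M\<close> in blast)+
  qed
  have "(\<integral>\<^sup>+ x. epow (F x) p \<partial>M) = (\<integral>\<^sup>+ x. (SUP n. epow (H n x) p) \<partial>M)"
    using p by (simp add: H(2) epow_SUP)
  also have "\<dots> = (SUP n. \<integral>\<^sup>+ x. epow (H n x) p \<partial>M)"
    using p H(1) by (intro nn_integral_monotone_convergence_SUP)
      (auto simp: incseq_def le_fun_def intro!: epow_mono)
  also have "\<dots> \<le> ennreal (2 * (2 * real k) powr p) * (\<integral>\<^sup>+ x. epow (G x) p \<partial>M)"
    by (intro SUP_least bd)
  finally show "(\<integral>\<^sup>+ x. epow (F x) p \<partial>M) \<le> ennreal (2 * (2 * real k) powr p) * (\<integral>\<^sup>+ x. epow (G x) p \<partial>M)" .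
  show "(SUP t\<in>{0<..}. ennreal t * epow (emeasure M {x \<in> space M. ennreal t < F x}) (1 / p))
      \<le> ennreal (2 * real k * 2 powr (1 / p))
        * (SUP t\<in>{0<..}. ennreal t * epow (emeasure M {x \<in> space M. ennreal t < G x}) (1 / p))"
    (is "_ \<le> ?R")
  proof (rule SUP_least)
    fix t :: real assume t: "t \<in> {0<..}"
    have "{x \<in> space M. ennreal t < F x} = (\<Union>n. {x \<in> space M. ennreal t < H n x})"
      by (auto simp: H(2) less_SUP_iff)
    also have "emeasure M \<dots> = (SUP n. emeasure M {x \<in> space M. ennreal t < H n x})"
    proof (rule SUP_emeasure_incseq[symmetric])
      show "incseq (\<lambda>n. {x \<in> space M. ennreal t < H n x})"
        using H(1) by (fastforce simp: incseq_def intro: less_le_trans)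
    qed auto
    finally have "ennreal t * epow (emeasure M {x \<in> space M. ennreal t < F x}) (1 / p)
      = (SUP n. ennreal t * epow (emeasure M {x \<in> space M. ennreal t < H n x}) (1 / p))"
      using p by (simp add: epow_SUP SUP_mult_left_ennreal)
    also have "\<dots> \<le> ?R"
    proof (rule SUP_least)
      show "ennreal t * epow (emeasure M {x \<in> space M. ennreal t < H n x}) (1 / p) \<le> ?R" for n
        by (rule order_trans[OF SUP_upper[OF t] bd(2)])
    qed
    finally show "ennreal t * epow (emeasure M {x \<in> space M. ennreal t < F x}) (1 / p) \<le> ?R" .
  qed
qed

section \<open>Cubes and dyadic grids\<close>

lemma cube_of_side_boxes:
  fixes Q :: "(real^'n) set"
  assumes "cube_of_side l Q"
  obtains a :: "real^'n" where "box a (a + (\<chi> i. l)) \<subseteq> Q" "Q \<subseteq> cbox a (a + (\<chi> i. l))"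
proof -
  obtain J where J: "\<forall>i. \<exists>a. {a<..<a + l} \<subseteq> J i \<and> J i \<subseteq> {a..a + l}"
    and Q: "Q = {x. \<forall>i. x $ i \<in> J i}"
    using assms by (auto simp: cube_of_side_def)
  obtain a where a: "\<And>i. {a i<..<a i + l} \<subseteq> J i \<and> J i \<subseteq> {a i..a i + l}"
    using J by metis
  show ?thesis
  proof (rule that[of "\<chi> i. a i"])
    show "box (\<chi> i. a i) ((\<chi> i. a i) + (\<chi> i. l)) \<subseteq> Q"
    proof
      fix x assume "x \<in> box (\<chi> i. a i) ((\<chi> i. a i) + (\<chi> i. l))"
      then have "x $ i \<in> {a i<..<a i + l}" for i by (simp add: mem_box_cart)
      then show "x \<in> Q" using a Q by blast
    qed
    show "Q \<subseteq> cbox (\<chi> i. a i) ((\<chi> i. a i) + (\<chi> i. l))"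
    proof
      fix x assume "x \<in> Q"
      then have "x $ i \<in> {a i..a i + l}" for i using a Q by blast
      then show "x \<in> cbox (\<chi> i. a i) ((\<chi> i. a i) + (\<chi> i. l))" by (simp add: mem_box_cart)
    qed
  qed
qed

lemma cube_lebesgue:
  fixes Q :: "(real^'n) set"
  assumes "cube_of_side l Q"
  shows "Q \<in> sets lebesgue" "emeasure lebesgue Q = ennreal (l ^ CARD('n))"
proof -
  have l: "0 < l" using assms by (simp add: cube_of_side_def)
  obtain a :: "real^'n" where a: "box a (a + (\<chi> i. l)) \<subseteq> Q" "Q \<subseteq> cbox a (a + (\<chi> i. l))"
    using cube_of_side_boxes[OF assms] .
  have "Q - box a (a + (\<chi> i. l)) \<in> null_sets lebesgue"
  proof (rule null_sets_completion_subset)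
    show "Q - box a (a + (\<chi> i. l)) \<subseteq> cbox a (a + (\<chi> i. l)) - box a (a + (\<chi> i. l))"
      using a by blast
    show "cbox a (a + (\<chi> i. l)) - box a (a + (\<chi> i. l)) \<in> null_sets lebesgue"
      by (intro null_sets_completionI null_sets_cbox_Diff_box)
  qed
  moreover have "Q = box a (a + (\<chi> i. l)) \<union> (Q - box a (a + (\<chi> i. l)))"
    using a by blast
  moreover have box: "box a (a + (\<chi> i. l)) \<in> sets lebesgue" by simp
  ultimately show Q: "Q \<in> sets lebesgue" by (metis null_setsD2 sets.Un)
  have len: "(\<chi> i. l) \<bullet> i = l" if "i \<in> Basis" for i :: "real^'n"
    using that by (auto simp: Basis_vec_def inner_axis)
  have "emeasure lborel (box a (a + (\<chi> i. l))) = ennreal (l ^ CARD('n))"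
       "emeasure lborel (cbox a (a + (\<chi> i. l))) = ennreal (l ^ CARD('n))"
    using l by (auto simp: emeasure_lborel_box_eq emeasure_lborel_cbox_eq inner_add_left len)
  moreover have "emeasure lebesgue (box a (a + (\<chi> i. l))) \<le> emeasure lebesgue Q"
    using a Q by (intro emeasure_mono) auto
  moreover have "emeasure lebesgue Q \<le> emeasure lebesgue (cbox a (a + (\<chi> i. l)))"
    using a by (intro emeasure_mono) auto
  ultimately show "emeasure lebesgue Q = ennreal (l ^ CARD('n))" by simp
qed

lemma side_length_eq:
  fixes Q :: "(real^'n) set"
  assumes "cube_of_side l Q"
  shows "side_length Q = l"
  unfolding side_length_def
proof (rule the_equality)
  fix l' assume l': "cube_of_side l' Q"
  have pos: "0 < l" "0 < l'" using assms l' by (auto simp: cube_of_side_def)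
  have "ennreal (l' ^ CARD('n)) = ennreal (l ^ CARD('n))"
    using cube_lebesgue(2)[OF assms] cube_lebesgue(2)[OF l'] by simp
  then have "l' ^ CARD('n) = l ^ CARD('n)" using pos by simp
  then show "l' = l" using pos by (simp add: power_eq_iff_eq_base)
qed fact

text \<open>
  The cubes of one generation are disjoint and have nonempty interior, and there are countably many
  generations.
\<close>

lemma dyadic_grid_countable:
  fixes D :: "(real^'n) set set"
  assumes "dyadic_grid D"
  shows "countable D"
proof -
  define L where "L k = {Q \<in> D. cube_of_side (2 powi k) Q}" for k :: int
  have "countable (L k)" for k
  proof (rule countable_disjoint_nonempty_interior_subsets)
    show "pairwise disjnt (L k)"
      using assms unfolding dyadic_grid_def L_def partition_on_def disjoint_def pairwise_def disjnt_def
      by blast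
    fix Q assume Q: "Q \<in> L k" "interior Q = {}"
    then have c: "cube_of_side (2 powi k) Q" by (simp add: L_def)
    then obtain a :: "real^'n" where a: "box a (a + (\<chi> i. 2 powi k)) \<subseteq> Q"
      using cube_of_side_boxes by blast
    have "box a (a + (\<chi> i. 2 powi k)) \<subseteq> interior Q"
      using a by (intro interior_maximal) auto
    moreover have "a + (\<chi> i. 2 powi k / 2) \<in> box a (a + (\<chi> i. 2 powi k))"
      by (simp add: mem_box_cart)
    ultimately show "Q = {}" using Q(2) by blast
  qed
  moreover have "D \<subseteq> (\<Union>k. L k)" using assms by (auto simp: dyadic_grid_def L_def)
  ultimately show ?thesis
    by (meson countable_UN countable_subset uncountable_def countableI_type)
qed

section \<open>Muckenhoupt weights\<close>

lemma sets_weighted_measure [simp, measurable_cong]: "sets (weighted_measure w) = sets lebesgue"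
  by (simp add: weighted_measure_def)

lemma space_weighted_measure [simp]: "space (weighted_measure w) = UNIV"
  by (simp add: weighted_measure_def)

lemma weighted_measure_compact_finite:
  fixes w :: "real^'n \<Rightarrow> real"
  assumes "is_weight w" "compact K"
  shows "emeasure (weighted_measure w) K < top"
proof -
  have K: "K \<in> sets lebesgue" using assms by (simp add: borel_compact lmeasurable_compact fmeasurableD)
  have w: "w \<in> borel_measurable lebesgue" "\<And>x. 0 \<le> w x"
    using assms by (auto simp: is_weight_def)
  have "w absolutely_integrable_on K" using assms by (simp add: is_weight_def)
  then have "integrable lebesgue (\<lambda>x. indicator K x *\<^sub>R w x)" by (simp add: set_integrable_def)
  then have "(\<integral>\<^sup>+ x. ennreal (norm (indicator K x *\<^sub>R w x)) \<partial>lebesgue) < \<infinity>"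
    by (simp add: integrable_iff_bounded)
  moreover have "ennreal (norm (indicator K x *\<^sub>R w x)) = ennreal (w x) * indicator K x" for x
    using w by (simp add: indicator_def)
  ultimately show ?thesis
    unfolding weighted_measure_def using w K by (subst emeasure_density) auto
qed

lemma weighted_measure_sigma_finite:
  fixes w :: "real^'n \<Rightarrow> real"
  assumes "is_weight w"
  shows "sigma_finite_measure (weighted_measure w)"
proof
  show "\<exists>A. countable A \<and> A \<subseteq> sets (weighted_measure w) \<and> \<Union> A = space (weighted_measure w)
      \<and> (\<forall>a\<in>A. emeasure (weighted_measure w) a \<noteq> \<infinity>)"
  proof (intro exI conjI ballI)
    show "\<Union> (range (\<lambda>n. cball (0::real^'n) (real n))) = space (weighted_measure w)"
      using real_arch_simple by auto
    show "emeasure (weighted_measure w) a \<noteq> \<infinity>" if "a \<in> range (\<lambda>n. cball 0 (real n))" for a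
      using that weighted_measure_compact_finite[OF assms, of a] by auto
  qed auto
qed

lemma cube_weighted_measure_finite:
  fixes w :: "real^'n \<Rightarrow> real"
  assumes "is_weight w" "cube_of_side l Q"
  shows "emeasure (weighted_measure w) Q < top"
proof -
  obtain a :: "real^'n" where "box a (a + (\<chi> i. l)) \<subseteq> Q" and a: "Q \<subseteq> cbox a (a + (\<chi> i. l))"
    using cube_of_side_boxes[OF assms(2)] .
  have "emeasure (weighted_measure w) Q \<le> emeasure (weighted_measure w) (cbox a (a + (\<chi> i. l)))"
    by (rule emeasure_mono[OF a]) simp
  also have "\<dots> < top" by (rule weighted_measure_compact_finite[OF assms(1)]) simp
  finally show ?thesis .
qed

lemma weighted_measure_eq_average:
  assumes "w \<in> borel_measurable lebesgue" "cube_of_side l Q"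
  shows "emeasure (weighted_measure w) Q = average Q (\<lambda>y. ennreal (w y)) * emeasure lebesgue Q"
proof -
  have "0 < l" using assms(2) by (simp add: cube_of_side_def)
  then have "emeasure lebesgue Q \<noteq> 0" "emeasure lebesgue Q < top"
    using cube_lebesgue(2)[OF assms(2)] by auto
  then have "average Q (\<lambda>y. ennreal (w y)) * emeasure lebesgue Q = (\<integral>\<^sup>+ x\<in>Q. ennreal (w x) \<partial>lebesgue)"
    unfolding average_def by (simp add: ennreal_divide_times)
  then show ?thesis
    unfolding weighted_measure_def using assms cube_lebesgue(1)[OF assms(2)]
    by (subst emeasure_density) auto
qed

text \<open>
  The average of \<open>w\<close> over \<open>Q\<close> is at most \<open>K w(x)\<close> for almost every \<open>x \<in> E\<close>; integrate this over \<open>E\<close>.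
\<close>

lemma muckenhoupt_1_large_subset:
  fixes w :: "real^'n \<Rightarrow> real"
  assumes "muckenhoupt 1 w"
  shows "\<exists>K\<ge>0. \<forall>Q E. is_cube Q \<longrightarrow> E \<in> sets lebesgue \<longrightarrow> E \<subseteq> Q \<longrightarrow>
    emeasure lebesgue Q \<le> 2 * emeasure lebesgue E \<longrightarrow>
    emeasure (weighted_measure w) Q \<le> ennreal K * emeasure (weighted_measure w) E"
proof -
  obtain K where K: "\<And>Q. is_cube Q \<Longrightarrow>
      AE x in lebesgue. x \<in> Q \<longrightarrow> average Q (\<lambda>y. ennreal (w y)) \<le> ennreal (K * w x)"
    using assms by (auto simp: muckenhoupt_def)
  have w: "w \<in> borel_measurable lebesgue" "\<And>x. 0 \<le> w x"
    using assms by (auto simp: muckenhoupt_def is_weight_def)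
  define K' where "K' = max 0 K"
  show ?thesis
  proof (intro exI[of _ "2 * K'"] conjI allI impI)
    fix Q E :: "(real^'n) set"
    assume Q: "is_cube Q" and E: "E \<in> sets lebesgue" "E \<subseteq> Q"
      and QE: "emeasure lebesgue Q \<le> 2 * emeasure lebesgue E"
    let ?a = "average Q (\<lambda>y. ennreal (w y))"
    obtain l where l: "cube_of_side l Q" using Q by (auto simp: is_cube_def)
    have "?a * emeasure lebesgue E = (\<integral>\<^sup>+ x. ?a * indicator E x \<partial>lebesgue)"
      using E by (simp add: nn_integral_cmult_indicator)
    also have "\<dots> \<le> (\<integral>\<^sup>+ x. ennreal K' * (ennreal (w x) * indicator E x) \<partial>lebesgue)"
    proof (rule nn_integral_mono_AE)
      show "AE x in lebesgue. ?a * indicator E x \<le> ennreal K' * (ennreal (w x) * indicator E x)"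
        using K[OF Q]
      proof eventually_elim
        case (elim x)
        show ?case
        proof (cases "x \<in> E")
          case True
          then have "?a \<le> ennreal (K * w x)" using elim E by auto
          also have "\<dots> \<le> ennreal (K' * w x)"
            using w by (intro ennreal_leI mult_right_mono) (auto simp: K'_def)
          finally show ?thesis using True w by (simp add: ennreal_mult K'_def)
        qed simp
      qed
    qed
    also have "\<dots> = ennreal K' * emeasure (weighted_measure w) E"
      unfolding weighted_measure_def using w E
      by (subst emeasure_density) (auto simp: nn_integral_cmult)
    finally have *: "?a * emeasure lebesgue E \<le> ennreal K' * emeasure (weighted_measure w) E" .
    have "emeasure (weighted_measure w) Q = ?a * emeasure lebesgue Q"
      by (rule weighted_measure_eq_average[OF w(1) l])
    also have "\<dots> \<le> ?a * (2 * emeasure lebesgue E)"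
      using QE by (rule mult_left_mono) simp
    also have "\<dots> = 2 * (?a * emeasure lebesgue E)" by (simp add: mult_ac)
    also have "\<dots> \<le> 2 * (ennreal K' * emeasure (weighted_measure w) E)"
      using * by (rule mult_left_mono) simp
    also have "\<dots> = ennreal (2 * K') * emeasure (weighted_measure w) E"
      by (simp add: ennreal_mult K'_def mult.assoc)
    finally show "emeasure (weighted_measure w) Q \<le> \<dots>" .
  qed (simp add: K'_def)
qed

text \<open>
  Let \<open>r = 1/(q-1)\<close> and let \<open>\<sigma>\<close> be the average of \<open>w\<^bsup>-r\<^esup>\<close> over \<open>Q\<close>.  Instead of Hoelder's inequality a
  Chebyshev argument suffices: \<open>w\<^bsup>-r\<^esup> \<ge> 4\<sigma>\<close> holds on at most a quarter of \<open>Q\<close>, whereas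
  \<open>(4\<sigma>)\<^bsup>1/r\<^esup> w > 1\<close> holds elsewhere, in particular on a part of \<open>E\<close> that has at least a quarter
  of the measure of \<open>Q\<close>.  Hence \<open>|Q|/4 \<le> (4\<sigma>)\<^bsup>q-1\<^esup> w(E)\<close>, and multiplying by the average of \<open>w\<close>
  over \<open>Q\<close> brings in the \<open>A\<^sub>q\<close> condition.
\<close>

lemma muckenhoupt_large_subset:
  fixes w :: "real^'n \<Rightarrow> real"
  assumes "muckenhoupt q w" "1 < q"
  shows "\<exists>K\<ge>0. \<forall>Q E. is_cube Q \<longrightarrow> E \<in> sets lebesgue \<longrightarrow> E \<subseteq> Q \<longrightarrow>
    emeasure lebesgue Q \<le> 2 * emeasure lebesgue E \<longrightarrow>
    emeasure (weighted_measure w) Q \<le> ennreal K * emeasure (weighted_measure w) E"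
proof -
  define r where "r = 1 / (q - 1)"
  have r: "0 < r" using assms by (simp add: r_def)
  have rq: "- 1 / (q - 1) = - r" "q - 1 = 1 / r"
    by (simp_all add: r_def)
  obtain K where K1: "\<And>Q. is_cube Q \<Longrightarrow>
      average Q (\<lambda>y. ennreal (w y)) * epow (average Q (\<lambda>y. ennreal (w y powr (- 1 / (q - 1))))) (q - 1) \<le> ennreal K"
    using assms unfolding muckenhoupt_def by auto
  note K = K1[unfolded rq(1), unfolded rq(2)]
  have w: "w \<in> borel_measurable lebesgue" "\<And>x. 0 \<le> w x" "AE x in lebesgue. 0 < w x"
    using assms by (auto simp: muckenhoupt_def is_weight_def)
  note [measurable] = w(1)
  define K' where "K' = max 0 K"
  have K': "0 \<le> K'" "ennreal K \<le> ennreal K'" by (auto simp: K'_def ennreal_leI)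
  show ?thesis
  proof (intro exI[of _ "4 * 4 powr (1 / r) * K'"] conjI allI impI)
    fix Q E :: "(real^'n) set"
    assume Q: "is_cube Q" and E: "E \<in> sets lebesgue" "E \<subseteq> Q"
      and QE: "emeasure lebesgue Q \<le> 2 * emeasure lebesgue E"
    define a where "a = average Q (\<lambda>y. ennreal (w y))"
    let ?W = "weighted_measure w"
    obtain l where l: "cube_of_side l Q" using Q by (auto simp: is_cube_def)
    then have l0: "0 < l" by (simp add: cube_of_side_def)
    define m where "m = l ^ CARD('n)"
    have m: "emeasure lebesgue Q = ennreal m" "0 < m"
      using cube_lebesgue(2)[OF l] l0 by (simp_all add: m_def)
    note [measurable] = cube_lebesgue(1)[OF l] E(1)
    have WQ: "emeasure ?W Q = a * ennreal m"
      unfolding a_def m(1)[symmetric] by (rule weighted_measure_eq_average[OF w(1) l])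
    have aK: "a * epow (average Q (\<lambda>y. ennreal (w y powr - r))) (1 / r) \<le> ennreal K'"
      using K[OF Q] K'(2) unfolding a_def by (rule order_trans)
    show "emeasure ?W Q \<le> ennreal (4 * 4 powr (1 / r) * K') * emeasure ?W E"
    proof (cases "a = 0")
      case True
      then show ?thesis by (simp add: WQ)
    next
      case False
      have "average Q (\<lambda>y. ennreal (w y powr - r)) \<noteq> top"
        using aK False by (auto simp: ennreal_mult_top top_unique)
      then obtain \<sigma> where \<sigma>: "average Q (\<lambda>y. ennreal (w y powr - r)) = ennreal \<sigma>" "0 \<le> \<sigma>"
        by (cases "average Q (\<lambda>y. ennreal (w y powr - r))") auto
      have int: "(\<integral>\<^sup>+ x\<in>Q. ennreal (w x powr - r) \<partial>lebesgue) = ennreal (\<sigma> * m)"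
      proof -
        have "(\<integral>\<^sup>+ x\<in>Q. ennreal (w x powr - r) \<partial>lebesgue) / ennreal m * ennreal m = ennreal (\<sigma> * m)"
          using \<sigma> m by (simp add: average_def ennreal_mult)
        then show ?thesis using m by (simp add: ennreal_divide_times)
      qed
      have "\<sigma> \<noteq> 0"
      proof
        assume "\<sigma> = 0"
        then have "AE x in lebesgue. ennreal (w x powr - r) * indicator Q x = 0"
          using int by (subst nn_integral_0_iff_AE[symmetric]) auto
        then have "AE x in lebesgue. x \<notin> Q"
          using w(3) by eventually_elim (auto simp: indicator_def split: if_splits)
        then have "emeasure lebesgue Q = 0"
          by (subst (asm) AE_iff_measurable[of Q]) auto
        then show False using m by simp
      qed
      then have \<sigma>0: "0 < \<sigma>" using \<sigma> by simp
      define t where "t = (4 * \<sigma>) powr (1 / r)"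
      \<comment> \<open>One of the two summands is at least \<open>1\<close>; this splits \<open>Q\<close> as in Chebyshev's inequality.\<close>
      have pointwise: "1 \<le> t * w x + w x powr - r / (4 * \<sigma>)" if "0 < w x" for x
      proof (cases "4 * \<sigma> \<le> w x powr - r")
        case True
        then have "1 \<le> w x powr - r / (4 * \<sigma>)" using \<sigma>0 by simp
        moreover have "0 \<le> t * w x" using w by (simp add: t_def)
        ultimately show ?thesis by simp
      next
        case False
        then have "(w x powr - r) powr (1 / r) \<le> (4 * \<sigma>) powr (1 / r)"
          using r by (intro powr_mono2) auto
        then have "w x powr - 1 \<le> t" using r by (simp add: powr_powr t_def)
        then have "1 \<le> t * w x" using that by (simp add: powr_minus field_simps)
        moreover have "0 \<le> w x powr - r / (4 * \<sigma>)" using \<sigma>0 by simp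
        ultimately show ?thesis by simp
      qed
      have "emeasure lebesgue E = (\<integral>\<^sup>+ x. indicator E x \<partial>lebesgue)"
        by simp
      also have "\<dots> \<le> (\<integral>\<^sup>+ x. ennreal t * (ennreal (w x) * indicator E x)
          + ennreal (1 / (4 * \<sigma>)) * (ennreal (w x powr - r) * indicator Q x) \<partial>lebesgue)"
      proof (rule nn_integral_mono_AE)
        show "AE x in lebesgue. indicator E x \<le> ennreal t * (ennreal (w x) * indicator E x)
          + ennreal (1 / (4 * \<sigma>)) * (ennreal (w x powr - r) * indicator Q x)"
          using w(3)
        proof eventually_elim
          case (elim x)
          have "0 \<le> t" by (simp add: t_def)
          have "ennreal t * ennreal (w x) + ennreal (1 / (4 * \<sigma>)) * ennreal (w x powr - r)
              = ennreal (t * w x + w x powr - r / (4 * \<sigma>))"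
            using \<sigma>0 w(2) \<open>0 \<le> t\<close> by (simp flip: ennreal_mult ennreal_plus)
          moreover have "1 \<le> \<dots>" using ennreal_leI[OF pointwise[OF elim]] by simp
          ultimately show ?case using E(2) by (auto simp: indicator_def)
        qed
      qed
      also have "\<dots> = ennreal t * emeasure ?W E + ennreal (1 / (4 * \<sigma>)) * ennreal (\<sigma> * m)"
        unfolding weighted_measure_def
        by (subst emeasure_density) (auto simp: nn_integral_add nn_integral_cmult int)
      also have "ennreal (1 / (4 * \<sigma>)) * ennreal (\<sigma> * m) = ennreal (m / 4)"
        using \<sigma>0 m by (simp flip: ennreal_mult)
      finally have "emeasure lebesgue E \<le> ennreal t * emeasure ?W E + ennreal (m / 4)" .
      then have "2 * emeasure lebesgue E \<le> 2 * (ennreal t * emeasure ?W E + ennreal (m / 4))"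
        by (rule mult_left_mono) simp
      then have half: "ennreal m \<le> 2 * (ennreal t * emeasure ?W E + ennreal (m / 4))"
        using QE m by simp
      have "ennreal m \<le> ennreal 4 * (ennreal t * emeasure ?W E)"
      proof (cases "ennreal t * emeasure ?W E")
        case top
        then show ?thesis by (simp add: ennreal_mult_top)
      next
        case (real v)
        have "ennreal 2 * (ennreal v + ennreal (m / 4)) = ennreal (2 * (v + m / 4))"
          using real(1) m(2) by (subst ennreal_mult) (auto simp: distrib_left)
        then have "ennreal m \<le> ennreal (2 * (v + m / 4))" using half real by simp
        then have "m \<le> 4 * v" using real m by (subst (asm) ennreal_le_iff) auto
        then have "ennreal m \<le> ennreal (4 * v)" by (rule ennreal_leI)
        then show ?thesis using real by (simp add: ennreal_mult)
      qed
      then have "a * ennreal m \<le> a * (ennreal 4 * (ennreal t * emeasure ?W E))"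
        by (rule mult_left_mono) simp
      also have "\<dots> = ennreal (4 * 4 powr (1 / r)) * ((a * epow (ennreal \<sigma>) (1 / r)) * emeasure ?W E)"
        using \<sigma>0 by (simp add: t_def powr_mult epow_ennreal ennreal_mult mult_ac)
      also have "\<dots> \<le> ennreal (4 * 4 powr (1 / r)) * (ennreal K' * emeasure ?W E)"
        using aK \<sigma> by (intro mult_left_mono mult_right_mono) auto
      also have "\<dots> = ennreal (4 * 4 powr (1 / r) * K') * emeasure ?W E"
        using K' by (simp add: ennreal_mult mult.assoc)
      finally show ?thesis by (simp add: WQ)
    qed
  qed (use K' in auto)
qed

lemma A_infty_large_subset:
  fixes w :: "real^'n \<Rightarrow> real"
  assumes "A_infty w"
  obtains K where "0 \<le> K"
    "\<And>Q E. is_cube Q \<Longrightarrow> E \<in> sets lebesgue \<Longrightarrow> E \<subseteq> Q \<Longrightarrow>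
       emeasure lebesgue Q \<le> 2 * emeasure lebesgue E \<Longrightarrow>
       emeasure (weighted_measure w) Q \<le> ennreal K * emeasure (weighted_measure w) E"
proof -
  obtain q where q: "1 \<le> q" "muckenhoupt q w" using assms by (auto simp: A_infty_def)
  show ?thesis
  proof (cases "q = 1")
    case True
    with q muckenhoupt_1_large_subset[of w] show ?thesis by (auto intro: that)
  next
    case False
    with q muckenhoupt_large_subset[of q w] show ?thesis by (auto intro: that)
  qed
qed

section \<open>The Riesz potential\<close>

text \<open>
  For \<open>d = 0\<close> the quotient is \<open>\<infinity>\<close> if \<open>g > 0\<close> and \<open>0\<close> if \<open>g = 0\<close>, which suits the singularity of the
  Riesz kernel.
\<close>

lemma ennreal_le_mult_divide:
  fixes g :: ennreal
  assumes "0 \<le> d" "d \<le> D" "0 < D"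
  shows "g \<le> ennreal D * (g / ennreal d)"
proof (cases "d = 0")
  case True
  then show ?thesis using assms by (cases "g = 0") (auto simp: ennreal_mult_top)
next
  case False
  have "g = ennreal d * (g / ennreal d)"
    using assms False by (simp add: ennreal_times_divide mult.commute mult_divide_eq_ennreal)
  also have "\<dots> \<le> ennreal D * (g / ennreal d)"
    using assms by (intro mult_right_mono ennreal_leI) auto
  finally show ?thesis .
qed

lemma cube_norm_diff_le:
  fixes Q :: "(real^'n) set"
  assumes "cube_of_side l Q" "x \<in> Q" "y \<in> Q"
  shows "norm (x - y) \<le> real CARD('n) * l"
proof -
  obtain a :: "real^'n" where "box a (a + (\<chi> i. l)) \<subseteq> Q" and a: "Q \<subseteq> cbox a (a + (\<chi> i. l))"
    using cube_of_side_boxes[OF assms(1)] .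
  have "norm (x - y) \<le> (\<Sum>i\<in>UNIV. \<bar>(x - y) $ i\<bar>)" by (rule norm_le_l1_cart)
  also have "\<dots> \<le> (\<Sum>i\<in>(UNIV :: 'n set). l)"
  proof (rule sum_mono)
    fix i
    have "x \<in> cbox a (a + (\<chi> i. l))" "y \<in> cbox a (a + (\<chi> i. l))" using a assms by auto
    then have "a $ i \<le> x $ i" "x $ i \<le> a $ i + l" "a $ i \<le> y $ i" "y $ i \<le> a $ i + l"
      by (auto simp: mem_box_cart)
    then show "\<bar>(x - y) $ i\<bar> \<le> l" by simp
  qed
  finally show ?thesis by simp
qed

text \<open>
  For \<open>x, y \<in> Q\<close> the kernel \<open>|x - y|\<^bsup>\<beta>-n\<^esup>\<close> is at least \<open>(nl)\<^bsup>\<beta>-n\<^esup>\<close>, so it suffices to keep the part of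
  the potential that comes from \<open>Q\<close>.
\<close>

lemma average_le_riesz_potential:
  fixes Q :: "(real^'n) set" and g :: "real^'n \<Rightarrow> ennreal" and \<beta> c l :: real
  assumes Q: "cube_of_side l Q" and x: "x \<in> Q" and \<beta>: "\<beta> \<le> CARD('n)" and c: "0 < c"
    and [measurable]: "g \<in> borel_measurable lebesgue"
  shows "ennreal (l powr \<beta>) * average Q g
    \<le> ennreal (CARD('n) powr (CARD('n) - \<beta>) / c) * riesz_potential c \<beta> g x"
proof -
  define N where "N = real CARD('n)"
  have N: "0 < N" by (simp add: N_def)
  have l: "0 < l" using Q by (simp add: cube_of_side_def)
  define D where "D = (N * l) powr (N - \<beta>)"
  have D: "0 < D" using l N by (simp add: D_def)
  define I where "I = (\<integral>\<^sup>+ y. g y / ennreal (norm (x - y) powr (N - \<beta>)) \<partial>lebesgue)"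
  have R: "riesz_potential c \<beta> g x = ennreal c * I"
    by (simp add: riesz_potential_def I_def N_def)
  have "(\<integral>\<^sup>+ y\<in>Q. g y \<partial>lebesgue) \<le> (\<integral>\<^sup>+ y. ennreal D * (g y / ennreal (norm (x - y) powr (N - \<beta>))) \<partial>lebesgue)"
  proof (rule nn_integral_mono)
    fix y
    show "g y * indicator Q y \<le> ennreal D * (g y / ennreal (norm (x - y) powr (N - \<beta>)))"
    proof (cases "y \<in> Q")
      case True
      have "norm (x - y) powr (N - \<beta>) \<le> D"
        unfolding D_def N_def using cube_norm_diff_le[OF Q x True] \<beta> by (intro powr_mono2) auto
      then show ?thesis using True D by (simp add: ennreal_le_mult_divide)
    qed simp
  qed
  also have "\<dots> = ennreal D * I"
  proof -
    have [measurable]: "(\<lambda>y. norm (x - y) powr (N - \<beta>)) \<in> borel_measurable lebesgue"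
      by (rule measurable_completion) measurable
    show ?thesis unfolding I_def by (rule nn_integral_cmult) measurable
  qed
  finally have "average Q g \<le> ennreal D * I / ennreal (l ^ CARD('n))"
    unfolding average_def cube_lebesgue(2)[OF Q] by (rule divide_right_mono_ennreal)
  also have "\<dots> = ennreal (D / l powr N) * I"
    using l D by (simp add: N_def powr_realpow ennreal_times_divide[symmetric] mult.commute
      divide_ennreal[symmetric] ennreal_divide_times)
  finally have "ennreal (l powr \<beta>) * average Q g \<le> ennreal (l powr \<beta>) * (ennreal (D / l powr N) * I)"
    by (rule mult_left_mono) simp
  also have "\<dots> = ennreal (l powr \<beta> * (D / l powr N)) * I"
    using D by (subst ennreal_mult) (auto simp: mult.assoc)
  also have "l powr \<beta> * (D / l powr N) = N powr (N - \<beta>) / c * c"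
    using l N c by (simp add: D_def powr_mult powr_diff)
  also have "ennreal \<dots> * I = ennreal (N powr (N - \<beta>) / c) * (ennreal c * I)"
    using c by (subst ennreal_mult) (auto simp: mult.assoc)
  finally show ?thesis by (simp add: R N_def)
qed

text \<open>
  A Borel representative of \<open>g\<close> gives the same potential at every point, and makes the integrand jointly
  Borel measurable.
\<close>

lemma riesz_potential_measurable:
  fixes g :: "real^'n \<Rightarrow> ennreal"
  assumes "g \<in> borel_measurable lebesgue"
  shows "riesz_potential c \<beta> g \<in> borel_measurable borel"
proof -
  obtain h :: "real^'n \<Rightarrow> ennreal" where h [measurable]: "h \<in> borel_measurable borel"
    and "AE y in lborel. g y = h y"
    using completion_ex_borel_measurable[OF assms] by auto
  then have "AE y in lebesgue. g y = h y" by (simp add: AE_completion)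
  then have "riesz_potential c \<beta> g
      = (\<lambda>x. ennreal c * (\<integral>\<^sup>+ y. h y / ennreal (norm (x - y) powr (CARD('n) - \<beta>)) \<partial>lborel))"
    unfolding riesz_potential_def fun_eq_iff nn_integral_completion[symmetric, where M = lborel]
    by (intro allI arg_cong2[where f = "(*)"] refl nn_integral_cong_AE) (auto elim: eventually_mono)
  also have "\<dots> \<in> borel_measurable borel"
    by measurable
  finally show ?thesis .
qed

section \<open>The sparse operator\<close>

lemma weak_norm_cmult_le:
  fixes R :: "'a \<Rightarrow> ennreal"
  assumes A: "0 < A"
  shows "(SUP t\<in>{0<..}. ennreal t * epow (emeasure M {x \<in> space M. ennreal t < ennreal A * R x}) q)
    \<le> ennreal A * (SUP t\<in>{0<..}. ennreal t * epow (emeasure M {x \<in> space M. ennreal t < R x}) q)"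
    (is "_ \<le> ennreal A * ?B")
proof (rule SUP_least)
  fix t :: real assume "t \<in> {0<..}"
  then have t: "0 < t" by simp
  have tA: "ennreal t = ennreal A * ennreal (t / A)"
    using t A by (simp flip: ennreal_mult)
  have "ennreal t < ennreal A * R x \<longleftrightarrow> ennreal (t / A) < R x" for x
    unfolding tA using A by (simp add: less_le_not_le ennreal_mult_le_mult_iff)
  then have "ennreal t * epow (emeasure M {x \<in> space M. ennreal t < ennreal A * R x}) q
     = ennreal A * (ennreal (t / A) * epow (emeasure M {x \<in> space M. ennreal (t / A) < R x}) q)"
    by (simp only: tA mult.assoc)
  also have "\<dots> \<le> ennreal A * ?B"
    using t A by (intro mult_left_mono SUP_upper) auto
  finally show "ennreal t * epow (emeasure M {x \<in> space M. ennreal t < ennreal A * R x}) q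
     \<le> ennreal A * ?B" .
qed

theorem theorem1p5:
  fixes \<alpha> s p c :: real and w :: "real^'n \<Rightarrow> real"
  assumes "0 < \<alpha>" and "\<alpha> < real CARD('n)"
    and "1 \<le> s" and "s < real CARD('n) / \<alpha>"
    and "0 < p"
    and "A_infty w"
    and "riesz_constant TYPE('n) (\<alpha> * s) c"
  shows "\<exists>C::real. 0 < C \<and>
    (\<forall>(S :: (real^'n) set set) (f :: real^'n \<Rightarrow> ennreal).
       sparse_family S \<longrightarrow> f \<in> borel_measurable lebesgue \<longrightarrow>
         Lp_norm p w (sparse_operator \<alpha> s S f)
           \<le> ennreal C * Lp_norm p w
               (\<lambda>x. epow (riesz_potential c (\<alpha> * s) (\<lambda>y. epow (f y) s) x) (1 / s)) \<and>
         weak_Lp_norm p w (sparse_operator \<alpha> s S f)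
           \<le> ennreal C * weak_Lp_norm p w
               (\<lambda>x. epow (riesz_potential c (\<alpha> * s) (\<lambda>y. epow (f y) s) x) (1 / s)))"
proof -
  define N where "N = real CARD('n)"
  define \<beta> where "\<beta> = \<alpha> * s"
  have N: "0 < N" by (simp add: N_def)
  have s: "0 < s" and p: "0 < p" using assms by auto
  have \<beta>: "\<beta> \<le> N" using assms(1,4) by (simp add: \<beta>_def N_def field_simps)
  have c: "0 < c" using assms(7) by (simp add: riesz_constant_def)
  let ?W = "weighted_measure w"
  have w: "is_weight w" using assms(6) by (auto simp: A_infty_def muckenhoupt_def)
  obtain K where K: "0 \<le> K" and large: "\<And>Q E. is_cube Q \<Longrightarrow> E \<in> sets lebesgue \<Longrightarrow> E \<subseteq> Q \<Longrightarrow>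
       emeasure lebesgue Q \<le> 2 * emeasure lebesgue E \<Longrightarrow>
       emeasure ?W Q \<le> ennreal K * emeasure ?W E"
    using A_infty_large_subset[OF assms(6)] by blast
  define k where "k = nat \<lceil>2 * 4 powr p * K\<rceil> + 1"
  have k: "0 < k" "2 * 4 powr p * K \<le> real k" unfolding k_def by (simp, linarith)
  define A where "A = (N powr (N - \<beta>) / c) powr (1 / s)"
  have A: "0 < A" using N c by (simp add: A_def)
  define C1 where "C1 = (2 * (2 * real k) powr p) powr (1 / p)"
  define C2 where "C2 = 2 * real k * 2 powr (1 / p)"
  define C where "C = max C1 C2 * A"
  have "0 < C2" using k by (simp add: C2_def)
  then have C: "0 < C" using A by (simp add: C_def less_max_iff_disj)
  show ?thesis
  proof (intro exI[of _ C] conjI allI impI C)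
    fix S :: "(real^'n) set set" and f :: "real^'n \<Rightarrow> ennreal"
    assume sp: "sparse_family S" and f [measurable]: "f \<in> borel_measurable lebesgue"
    define g where "g = (\<lambda>y. epow (f y) s)"
    have g: "g \<in> borel_measurable lebesgue" unfolding g_def by measurable
    define R where "R = (\<lambda>x. epow (riesz_potential c \<beta> g x) (1 / s))"
    have "R \<in> borel_measurable borel"
      unfolding R_def by (rule epow_measurable[OF riesz_potential_measurable[OF g]])
    then have "R \<in> borel_measurable lborel" by simp
    then have "R \<in> borel_measurable lebesgue" by (rule measurable_completion)
    then have [measurable]: "R \<in> borel_measurable ?W"
      by (simp add: measurable_cong_sets[OF sets_weighted_measure refl])
    define G where "G = (\<lambda>x. ennreal A * R x)"
    have G: "G \<in> borel_measurable ?W" unfolding G_def by measurable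
    define a where "a = (\<lambda>Q. ennreal (side_length Q powr \<alpha>) * epow (average Q g) (1 / s))"
    have F: "sparse_operator \<alpha> s S f = (\<lambda>x. \<Sum>\<^sub>\<infinity>P\<in>S. a P * indicator P x)"
      by (simp add: fun_eq_iff sparse_operator_def a_def g_def)
    obtain D where D: "dyadic_grid D" "S \<subseteq> D" using sp by (auto simp: sparse_family_def)
    obtain E where E: "\<And>Q. Q \<in> S \<Longrightarrow> E Q \<in> sets lebesgue" "\<And>Q. Q \<in> S \<Longrightarrow> E Q \<subseteq> Q"
      "\<And>Q. Q \<in> S \<Longrightarrow> emeasure lebesgue Q \<le> 2 * emeasure lebesgue (E Q)" "disjoint_family_on E S"
      using sp unfolding sparse_family_def by blast
    have cube: "\<exists>l. cube_of_side l Q" if "Q \<in> S" for Q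
      using D that unfolding dyadic_grid_def by blast
    have "laminar D" using D(1) unfolding dyadic_grid_def laminar_def by (elim conjE)
    then have lam: "laminar S" using D(2) by (rule laminar_subset)
    have cnt: "countable S" using dyadic_grid_countable[OF D(1)] D(2) by (rule countable_subset[rotated])
    have sets: "S \<subseteq> sets ?W" using cube cube_lebesgue(1) by (auto simp: subset_eq) 
    have fin: "emeasure ?W P < top" if "P \<in> S" for P
      using cube[OF that] cube_weighted_measure_finite[OF w] by blast
    have EW: "E P \<in> sets ?W" if "P \<in> S" for P using E(1)[OF that] by simp
    have EK: "emeasure ?W P \<le> ennreal K * emeasure ?W (E P)" if "P \<in> S" for P
      using large[of P "E P"] E(1-3)[OF that] cube[OF that] by (simp add: is_cube_def)
    \<comment> \<open>The factor \<open>\<ell>(P)\<^sup>\<alpha>\<close> is \<open>(\<ell>(P)\<^sup>\<beta>)\<^bsup>1/s\<^esup>\<close>, which reduces this to the comparison with the potential.\<close>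
    have aG: "a P \<le> G x" if P: "P \<in> S" and x: "x \<in> P" for P x
    proof -
      obtain l where l: "cube_of_side l P" using cube[OF P] by blast
      then have "0 < l" by (simp add: cube_of_side_def)
      have "a P = epow (ennreal (l powr \<beta>) * average P g) (1 / s)"
        using s by (simp add: a_def side_length_eq[OF l] epow_mult epow_ennreal powr_powr \<beta>_def)
      also have "\<dots> \<le> epow (ennreal (N powr (N - \<beta>) / c) * riesz_potential c \<beta> g x) (1 / s)"
        using average_le_riesz_potential[OF l x _ c g, of \<beta>] \<beta> s
        by (intro epow_mono) (simp_all add: N_def)
      also have "\<dots> = G x"
        using N c by (simp add: G_def R_def A_def epow_mult epow_ennreal)
      finally show ?thesis .
    qed
    note bounds = laminar_sum_bounds[OF weighted_measure_sigma_finite[OF w] p K cnt lam sets,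
        where E = E and a = a and G = G and k = k]
    have strong: "(\<integral>\<^sup>+ x. epow (sparse_operator \<alpha> s S f x) p \<partial>?W)
        \<le> ennreal (2 * (2 * real k) powr p) * (\<integral>\<^sup>+ x. epow (G x) p \<partial>?W)"
      unfolding F by (rule bounds(1)) (use fin EW E(2) EK E(4) G aG k in blast)+
    define I where "I = (\<integral>\<^sup>+ x. epow (R x) p \<partial>?W)"
    have "Lp_norm p w (sparse_operator \<alpha> s S f)
        \<le> epow (ennreal (2 * (2 * real k) powr p) * (\<integral>\<^sup>+ x. epow (G x) p \<partial>?W)) (1 / p)"
      unfolding Lp_norm_def using p by (intro epow_mono strong) auto
    also have "(\<integral>\<^sup>+ x. epow (G x) p \<partial>?W) = ennreal (A powr p) * I"
      using A by (simp add: G_def I_def epow_mult epow_ennreal nn_integral_cmult)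
    also have "epow (ennreal (2 * (2 * real k) powr p) * (ennreal (A powr p) * I)) (1 / p)
        = ennreal (C1 * A) * epow I (1 / p)"
    proof -
      have "epow (ennreal (2 * (2 * real k) powr p)) (1 / p) = ennreal C1"
        unfolding C1_def by (rule epow_ennreal) simp
      moreover have "epow (ennreal (A powr p)) (1 / p) = ennreal A"
        using A p by (simp add: epow_ennreal powr_powr)
      moreover have "ennreal (C1 * A) = ennreal C1 * ennreal A"
        using A by (intro ennreal_mult) (auto simp: C1_def)
      ultimately show ?thesis by (simp only: epow_mult mult.assoc)
    qed
    also have "\<dots> \<le> ennreal C * epow I (1 / p)"
      using A unfolding C_def by (intro mult_right_mono ennreal_leI) auto
    finally show "Lp_norm p w (sparse_operator \<alpha> s S f)
           \<le> ennreal C * Lp_norm p w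
               (\<lambda>x. epow (riesz_potential c (\<alpha> * s) (\<lambda>y. epow (f y) s) x) (1 / s))"
      by (simp add: I_def Lp_norm_def R_def \<beta>_def g_def)
    have weak: "weak_Lp_norm p w h
       = (SUP t\<in>{0<..}. ennreal t * epow (emeasure ?W {x \<in> space ?W. ennreal t < h x}) (1 / p))" for h
      by (simp add: weak_Lp_norm_def)
    have "weak_Lp_norm p w (sparse_operator \<alpha> s S f) \<le> ennreal C2 * weak_Lp_norm p w G"
      unfolding weak C2_def F by (rule bounds(2)) (use fin EW E(2) EK E(4) G aG k in blast)+
    also have "\<dots> \<le> ennreal C2 * (ennreal A * weak_Lp_norm p w R)"
      unfolding weak G_def by (intro mult_left_mono weak_norm_cmult_le A) simp
    also have "\<dots> = ennreal (C2 * A) * weak_Lp_norm p w R"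
      using A k by (simp add: C2_def ennreal_mult mult.assoc)
    also have "\<dots> \<le> ennreal C * weak_Lp_norm p w R"
      using A unfolding C_def by (intro mult_right_mono ennreal_leI) auto
    finally show "weak_Lp_norm p w (sparse_operator \<alpha> s S f)
           \<le> ennreal C * weak_Lp_norm p w
               (\<lambda>x. epow (riesz_potential c (\<alpha> * s) (\<lambda>y. epow (f y) s) x) (1 / s))"
      by (simp add: R_def \<beta>_def g_def)
  qed
qed

end
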